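(* Let $\mu$ be a quasi-definite complex Borel measure supported on $\mathbb T$, $\vec n=(n_+,n_-)\in\mathbb Z_+^2$, $l$ a non-negative integer, and let $K_{\vec n}^{[l]}(z,z')=\sum_{k=0}^{l-1}\varphi_{\vec n,1}^{(k)}(z')\,\bar\varphi_{\vec n,2}^{(k)}(\bar z)$ be the Christoffel--Darboux kernel. Then: 1. $K_{\vec n}^{[l]}$ is the integral kernel of the projections $\pi_{\vec n,1}^{(l)}$, $\pi_{\vec n,2}^{(l)}$: for every Laurent polynomial $f$, $$(\pi^{(l)}_{\vec n,1}f)(z')=\oint_{\mathbb T}K_{\vec n}^{[l]}(z,z')f(z)\,d\mu(z),\qquad \overline{(\pi^{(l)}_{\vec n,2}f)(z)}=\oint_{\mathbb T}K_{\vec n}^{[l]}(z,z')\,\bar f(\bar z')\,d\mu(z').$$ 2. The kernel has the reproducing property $K^{[l]}_{\vec n}(z,z')=\oint_{\mathbb T}K^{[l]}_{\vec n}(z,u)K^{[l]}_{\vec n}(u,z')\,d\mu(u)$. 3. $K^{[l]}_{\vec n}(z,z')=\chi^{[l]}_{\vec n}(z)^\dagger(g_{\vec n}^{[l]})^{-1}\chi_{\vec n}^{[l]}(z')$. 4. The kernel satisfies $$\begin{aligned}(z'-\bar z^{-1})K_{\vec n}^{[l]}(z,z')&=\chi^{[l]}_{\vec n}(z)^\dagger(g_{\vec n}^{[l]})^{-1}z'\chi^{[l]}_{\vec n}(z')-\bar z^{-1}\chi_{\vec n}^{[l]}(z)^\dagger(g_{\vec n}^{[l]})^{-1}\chi_{\vec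 n}^{[l]}(z')\\&=\big(\chi_{\vec n}^{[l]}(z)^\dagger(g_{\vec n}^{[l]})^{-1}g_{\vec n}^{[l,\ge l]}-\chi_{\vec n}^{[\ge l]}(z)^\dagger\big)\Upsilon_{\vec n}^{[\ge l,l]}(g_{\vec n}^{[l]})^{-1}\chi_{\vec n}^{[l]}(z')\\&\quad-\chi_{\vec n}^{[l]}(z)^\dagger(g_{\vec n}^{[l]})^{-1}\Upsilon_{\vec n}^{[l,\ge l]}\big(g_{\vec n}^{[\ge l,l]}(g_{\vec n}^{[l]})^{-1}\chi_{\vec n}^{[l]}(z')-\chi_{\vec n}^{[\ge l]}(z')\big).\end{aligned}$$
   Context: $\mathbb T$ is the unit circle; $\mathbb Z_+=\{0,1,2,\dots\}$; $\mu$ is quasi-definite if all Toeplitz matrices $\big(\oint_{\mathbb T}z^{i-j}d\mu\big)_{i,j=0}^n$, $n\ge0$, are non-singular. Indices start at $0$; $\dagger$ is the conjugate transpose. For a Laurent polynomial $f=\sum f_kz^k$, $\bar f(z)=\sum\overline{f_k}z^k$. Sesquilinear form: $\langle f,h\rangle=\oint_{\mathbb T}f(z)\,\bar h(z^{-1})\,d\mu(z)$. Extended ordering: $\chi_{\vec n}=(1,z,\dots,z^{n_+-1},z^{-1},z^{-2},\dots,z^{-n_-},z^{n_+},z^{n_++1},\dots)^\top$ (alternately $n_+$ increasing non-negative powers and $n_-$ decreasing negative powers of $z$). $g_{\vec n}=\oint_{\mathbb T}\chi_{\vec n}\chi_{\vec n}^\dagger d\mu=S_{\vec n,1}^{-1}S_{\vec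 n,2}$ with $S_{\vec n,1}$ lower triangular with unit diagonal, $S_{\vec n,2}$ upper triangular; $\varphi_{\vec n,1}^{(k)}=(S_{\vec n,1}\chi_{\vec n})^{(k)}$, $\varphi_{\vec n,2}^{(k)}=((S_{\vec n,2}^{-1})^\dagger\chi_{\vec n})^{(k)}$. Projections: let $\Lambda_{[\infty]}$ be the space of all Laurent polynomials, $\Lambda_{\vec n}^{[l]}=\mathrm{span}_{\mathbb C}\{\chi_{\vec n}^{(0)},\dots,\chi_{\vec n}^{(l-1)}\}$, and let $(\Lambda^{[l]}_{\vec n})^{\bot_1}$ be the set of finite linear combinations of the $\varphi_{\vec n,2}^{(k)}$, $k\ge l$, and $(\Lambda^{[l]}_{\vec n})^{\bot_2}$ the set of finite linear combinations of the $\varphi_{\vec n,1}^{(k)}$, $k\ge l$, so that $\langle\Lambda^{[l]}_{\vec n},(\Lambda^{[l]}_{\vec n})^{\bot_1}\rangle=0$ and $\langle(\Lambda^{[l]}_{\vec n})^{\bot_2},\Lambda^{[l]}_{\vec n}\rangle=0$. The splittings $\Lambda_{[\infty]}=\Lambda^{[l]}_{\vec n}\oplus(\Lambda^{[l]}_{\vec n})^{\bot_1}$ and $\Lambda_{[\infty]}=\Lambda^{[l]}_{\vec n}\oplus(\Lambda^{[l]}_{\vec n})^{\bot_2}$ induce, respectively, the projections $\pi^{(l)}_{\vec n,1}$ and $\pi^{(l)}_{\vec n,2}$ from $\Lambda_{[\infty]}$ onto $\Lambda^{[l]}_{\vec n}$. Shift matrix: let $e_j$ be the canonical basis vectors, $e_1(k)=e_j$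 where $\chi_{\vec n}^{(j)}=z^k$, and $e_2(k)=e_j$ where $\chi_{\vec n}^{(j)}=z^{-k-1}$ ($k\ge0$); $\Lambda_{\vec n,a}=\sum_{k\ge0}e_a(k)e_a(k+1)^\top$, $\Lambda=\sum_{j\ge0}E_{j,j+1}$ with $E_{i,j}$ the matrix units, and $\Upsilon_{\vec n}=\Lambda_{\vec n,1}+\Lambda_{\vec n,2}^\top+E_{n_+,n_+}(\Lambda^\top)^{n_+}$. It satisfies $\Upsilon_{\vec n}\chi_{\vec n}(z)=z\chi_{\vec n}(z)$. Blocks: for a semi-infinite matrix $M$, $M^{[l]}$, $M^{[l,\ge l]}$, $M^{[\ge l,l]}$ are the blocks with (rows, columns) in ($<l$, $<l$), ($<l$, $\ge l$), ($\ge l$, $<l$); for a vector $v$, $v^{[l]}$ and $v^{[\ge l]}$ are its components of index $<l$ and $\ge l$.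
   Formalization: In item 1 the two projections are interchanged (the first formula gives π_2, the second π_1), as the printed pairing fails for non-real measures; n=(0,0) is excluded, and item 1 and the last equality of item 4 are stated for n_+,n_->0 only. *)

theory Defs
  imports
    "HOL-Analysis.Analysis"
    "HOL-Library.Poly_Mapping"
    "Jordan_Normal_Form.Determinant"
    "Jordan_Normal_Form.Gauss_Jordan_Elimination"
begin

section \<open>Complex Borel measures\<close>

(* A complex measure is a set function; its values off the Borel sets are irrelevant. *)
definition complex_borel_measure :: "(complex set \<Rightarrow> complex) \<Rightarrow> bool" where
  "complex_borel_measure \<mu> \<longleftrightarrow>
     (\<forall>A :: nat \<Rightarrow> complex set. range A \<subseteq> sets borel \<longrightarrow> disjoint_family A \<longrightarrow>
        (\<lambda>i. \<mu> (A i)) sums \<mu> (\<Union>i. A i))"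

definition supported_on_circle :: "(complex set \<Rightarrow> complex) \<Rightarrow> bool" where
  "supported_on_circle \<mu> \<longleftrightarrow> (\<forall>A \<in> sets borel. A \<inter> sphere 0 1 = {} \<longrightarrow> \<mu> A = 0)"

definition signed_borel_measure :: "(complex set \<Rightarrow> real) \<Rightarrow> bool" where
  "signed_borel_measure \<nu> \<longleftrightarrow>
     (\<forall>A :: nat \<Rightarrow> complex set. range A \<subseteq> sets borel \<longrightarrow> disjoint_family A \<longrightarrow>
        (\<lambda>i. \<nu> (A i)) sums \<nu> (\<Union>i. A i))"

(* The positive variation of the Jordan decomposition. Negative values of nu are clipped to 0 by
   ennreal, and B = {} contributes 0. *)
definition pos_var :: "(complex set \<Rightarrow> real) \<Rightarrow> complex set \<Rightarrow> ennreal" where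
  "pos_var \<nu> A = (SUP B \<in> {B \<in> sets borel. B \<subseteq> A}. ennreal (\<nu> B))"

definition pos_part :: "(complex set \<Rightarrow> real) \<Rightarrow> complex measure" where
  "pos_part \<nu> = measure_of UNIV (sets borel) (pos_var \<nu>)"

definition cintegral :: "(complex set \<Rightarrow> complex) \<Rightarrow> (complex \<Rightarrow> complex) \<Rightarrow> complex" where
  "cintegral \<mu> f =
     ((\<integral>z. f z \<partial>pos_part (\<lambda>A. Re (\<mu> A))) - (\<integral>z. f z \<partial>pos_part (\<lambda>A. - Re (\<mu> A))))
     + \<i> * ((\<integral>z. f z \<partial>pos_part (\<lambda>A. Im (\<mu> A))) - (\<integral>z. f z \<partial>pos_part (\<lambda>A. - Im (\<mu> A))))"

lemma signed_empty: assumes "signed_borel_measure \<nu>" shows "\<nu> {} = 0"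
proof -
  have "(\<lambda>i::nat. \<nu> ((\<lambda>_. {}) i)) sums \<nu> (\<Union>i::nat. (\<lambda>_. {}) i)"
    using assms unfolding signed_borel_measure_def
    by (rule allE[where x="\<lambda>_. {}"]) (auto simp: disjoint_family_on_def)
  then have "summable (\<lambda>i::nat. \<nu> {})" by (auto simp: sums_iff)
  then show ?thesis by (simp add: summable_const_iff)
qed

lemma signed_Un: assumes s: "signed_borel_measure \<nu>" and A: "A \<in> sets borel" "B \<in> sets borel" "A \<inter> B = {}"
  shows "\<nu> (A \<union> B) = \<nu> A + \<nu> B"
proof -
  have "(\<lambda>i::nat. \<nu> (binaryset A B i)) sums \<nu> (\<Union>i. binaryset A B i)"
    using s unfolding signed_borel_measure_def
    by (rule allE[where x="binaryset A B"])
       (use A in \<open>auto simp: disjoint_family_on_def binaryset_def split: if_splits\<close>)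
  moreover have "(\<lambda>i::nat. \<nu> (binaryset A B i)) sums (\<nu> A + \<nu> B)"
    by (rule binaryset_sums) (rule signed_empty[OF s])
  ultimately show ?thesis by (metis UN_binaryset_eq sums_unique2)
qed

lemma pos_var_upper: "B \<in> sets borel \<Longrightarrow> B \<subseteq> A \<Longrightarrow> ennreal (\<nu> B) \<le> pos_var \<nu> A"
  unfolding pos_var_def by (rule SUP_upper) auto

lemma pos_var_Un: assumes s: "signed_borel_measure \<nu>" and A: "A1 \<inter> A2 = {}"
  shows "pos_var \<nu> A1 + pos_var \<nu> A2 \<le> pos_var \<nu> (A1 \<union> A2)"
proof -
  have "ennreal (\<nu> B1) + ennreal (\<nu> B2) \<le> pos_var \<nu> (A1 \<union> A2)"
    if B: "B1 \<in> sets borel" "B1 \<subseteq> A1" "B2 \<in> sets borel" "B2 \<subseteq> A2" for B1 B2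
  proof -
    have "ennreal (\<nu> B1) \<le> pos_var \<nu> (A1 \<union> A2)" "ennreal (\<nu> B2) \<le> pos_var \<nu> (A1 \<union> A2)"
      using B by (auto intro!: pos_var_upper)
    moreover have "ennreal (\<nu> (B1 \<union> B2)) \<le> pos_var \<nu> (A1 \<union> A2)"
      using B by (intro pos_var_upper) auto
    moreover have "\<nu> (B1 \<union> B2) = \<nu> B1 + \<nu> B2" using B A by (intro signed_Un[OF s]) auto
    ultimately show ?thesis
      by (cases "\<nu> B1 \<ge> 0"; cases "\<nu> B2 \<ge> 0") (auto simp: ennreal_neg ennreal_plus)
  qed
  note * = this
  have "pos_var \<nu> A1 + pos_var \<nu> A2 =
     (SUP B1 \<in> {B \<in> sets borel. B \<subseteq> A1}. SUP B2 \<in> {B \<in> sets borel. B \<subseteq> A2}. ennreal (\<nu> B1) + ennreal (\<nu> B2))"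
    unfolding pos_var_def
    apply (subst ennreal_SUP_add_left[symmetric], blast)
    apply (rule SUP_cong[OF refl])
    apply (subst ennreal_SUP_add_right, auto)
    done
  also have "\<dots> \<le> pos_var \<nu> (A1 \<union> A2)"
    by (intro SUP_least) (use * in auto)
  finally show ?thesis .
qed

lemma pos_var_mono: "A \<subseteq> B \<Longrightarrow> pos_var \<nu> A \<le> pos_var \<nu> B"
  unfolding pos_var_def by (rule SUP_subset_mono) auto

lemma pos_var_empty: "signed_borel_measure \<nu> \<Longrightarrow> pos_var \<nu> {} = 0"
proof -
  assume s: "signed_borel_measure \<nu>"
  have "{B \<in> sets borel. B \<subseteq> ({}::complex set)} = {{}}" by auto
  then show ?thesis by (simp add: pos_var_def signed_empty[OF s])
qed

lemma pos_var_ca: assumes s: "signed_borel_measure \<nu>"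
  shows "countably_additive (sets borel) (pos_var \<nu>)"
proof (rule countably_additiveI)
  fix A :: "nat \<Rightarrow> complex set"
  assume A: "range A \<subseteq> sets borel" "disjoint_family A"
  have fin: "(\<Sum>i<n. pos_var \<nu> (A i)) \<le> pos_var \<nu> (\<Union>i<n. A i)" for n
  proof (induction n)
    case (Suc n)
    have dj: "(\<Union>i<n. A i) \<inter> A n = {}"
      using A(2) by (auto simp: disjoint_family_on_def) (metis IntI empty_iff less_irrefl)
    have "(\<Sum>i<Suc n. pos_var \<nu> (A i)) \<le> pos_var \<nu> (\<Union>i<n. A i) + pos_var \<nu> (A n)"
      using Suc by (simp add: add_mono)
    also have "\<dots> \<le> pos_var \<nu> ((\<Union>i<n. A i) \<union> A n)"
      by (rule pos_var_Un[OF s dj])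
    also have "(\<Union>i<n. A i) \<union> A n = (\<Union>i<Suc n. A i)" by (auto simp: lessThan_Suc)
    finally show ?case .
  qed (simp add: pos_var_empty[OF s])
  show "suminf (\<lambda>i. pos_var \<nu> (A i)) = pos_var \<nu> (\<Union>i. A i)"
  proof (rule antisym)
    have "(\<Sum>i<n. pos_var \<nu> (A i)) \<le> pos_var \<nu> (\<Union>i. A i)" for n
      by (rule order_trans[OF fin pos_var_mono]) auto
    then show "suminf (\<lambda>i. pos_var \<nu> (A i)) \<le> pos_var \<nu> (\<Union>i. A i)"
      by (intro suminf_le_const) auto
  next
    show "pos_var \<nu> (\<Union>i. A i) \<le> suminf (\<lambda>i. pos_var \<nu> (A i))"
      unfolding pos_var_def[of _ "\<Union>i. A i"]
    proof (rule SUP_least)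
      fix B assume B: "B \<in> {B \<in> sets borel. B \<subseteq> (\<Union>i. A i)}"
      have "(\<lambda>i. \<nu> ((\<lambda>i. B \<inter> A i) i)) sums \<nu> (\<Union>i. (\<lambda>i. B \<inter> A i) i)"
        using s unfolding signed_borel_measure_def
        apply (rule allE[where x="\<lambda>i. B \<inter> A i"])
        using A B by (auto simp: disjoint_family_on_def)
      moreover have "(\<Union>i. B \<inter> A i) = B" using B by auto
      ultimately have sm: "(\<lambda>i. \<nu> (B \<inter> A i)) sums \<nu> B" by simp
      then have "(\<lambda>n. \<Sum>i<n. \<nu> (B \<inter> A i)) \<longlonglongrightarrow> \<nu> B" by (simp add: sums_def)
      then have "(\<lambda>n. ennreal (\<Sum>i<n. \<nu> (B \<inter> A i))) \<longlonglongrightarrow> ennreal (\<nu> B)"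
        by (rule tendsto_ennrealI)
      moreover have "ennreal (\<Sum>i<n. \<nu> (B \<inter> A i)) \<le> suminf (\<lambda>i. pos_var \<nu> (A i))" for n
      proof -
        have "ennreal (\<Sum>i<n. \<nu> (B \<inter> A i)) \<le> ennreal (\<Sum>i<n. max 0 (\<nu> (B \<inter> A i)))"
          by (intro ennreal_leI sum_mono) auto
        also have "\<dots> = (\<Sum>i<n. ennreal (max 0 (\<nu> (B \<inter> A i))))"
          by (subst sum_ennreal) auto
        also have "\<dots> \<le> (\<Sum>i<n. pos_var \<nu> (A i))"
          using A B by (intro sum_mono) (auto simp: ennreal_max_0 intro!: pos_var_upper)
        also have "\<dots> \<le> suminf (\<lambda>i. pos_var \<nu> (A i))" by (rule sum_le_suminf) auto
        finally show ?thesis .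
      qed
      ultimately show "ennreal (\<nu> B) \<le> suminf (\<lambda>i. pos_var \<nu> (A i))"
        by (intro LIMSEQ_le_const2) auto
    qed
  qed
qed

lemma emeasure_pos_part: assumes s: "signed_borel_measure \<nu>" and A: "A \<in> sets borel"
  shows "emeasure (pos_part \<nu>) A = pos_var \<nu> A"
  unfolding pos_part_def
  apply (rule emeasure_measure_of_sigma)
  using sets.sigma_algebra_axioms[of "borel :: complex measure"] apply simp
  using pos_var_empty[OF s] pos_var_ca[OF s] A by (auto simp: positive_def)

lemma pos_var_finite: assumes s: "signed_borel_measure \<nu>"
  shows "pos_var \<nu> UNIV < \<infinity>"
proof (rule ccontr)
  assume "\<not> pos_var \<nu> UNIV < \<infinity>"
  then have inf: "pos_var \<nu> UNIV = \<infinity>" by (metis infinity_ennreal_def top.not_eq_extremum)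
  have step: "\<exists>F \<in> sets borel. F \<subseteq> E \<and> pos_var \<nu> F = \<infinity> \<and> \<bar>\<nu> (E - F)\<bar> > 1"
    if E: "E \<in> sets borel" "pos_var \<nu> E = \<infinity>" for E
  proof -
    have "ennreal (2 + \<bar>\<nu> E\<bar>) < pos_var \<nu> E" using E by simp
    then obtain B where B: "B \<in> sets borel" "B \<subseteq> E" "ennreal (2 + \<bar>\<nu> E\<bar>) < ennreal (\<nu> B)"
      unfolding pos_var_def less_SUP_iff by auto
    then have b: "2 + \<bar>\<nu> E\<bar> < \<nu> B" by (subst (asm) ennreal_less_iff) auto
    have "\<nu> (B \<union> (E - B)) = \<nu> B + \<nu> (E - B)" using B E by (intro signed_Un[OF s]) auto
    moreover have U: "B \<union> (E - B) = E" using B by auto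
    ultimately have c: "\<nu> E = \<nu> B + \<nu> (E - B)" by simp
    have "emeasure (pos_part \<nu>) (B \<union> (E - B)) \<le> emeasure (pos_part \<nu>) B + emeasure (pos_part \<nu>) (E - B)"
      by (rule emeasure_subadditive) (use B E in \<open>auto simp: pos_part_def\<close>)
    then have "pos_var \<nu> E \<le> pos_var \<nu> B + pos_var \<nu> (E - B)"
      unfolding U using B E by (simp add: emeasure_pos_part[OF s])
    then have "pos_var \<nu> B = \<infinity> \<or> pos_var \<nu> (E - B) = \<infinity>"
      using E by (auto simp: top_unique)
    then show ?thesis
    proof
      assume "pos_var \<nu> B = \<infinity>"
      then show ?thesis using b c B by (intro bexI[of _ B]) auto
    next
      assume "pos_var \<nu> (E - B) = \<infinity>"
      moreover have "E - (E - B) = B" using B by auto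
      ultimately show ?thesis using b c B E by (intro bexI[of _ "E - B"]) auto
    qed
  qed
  define nxt where "nxt E = (SOME F. F \<in> sets borel \<and> F \<subseteq> E \<and> pos_var \<nu> F = \<infinity> \<and> \<bar>\<nu> (E - F)\<bar> > 1)" for E
  have nxt: "nxt E \<in> sets borel \<and> nxt E \<subseteq> E \<and> pos_var \<nu> (nxt E) = \<infinity> \<and> \<bar>\<nu> (E - nxt E)\<bar> > 1"
    if "E \<in> sets borel" "pos_var \<nu> E = \<infinity>" for E
    unfolding nxt_def by (rule someI_ex) (use step[OF that] in blast)
  define E where "E n = (nxt ^^ n) UNIV" for n
  have E: "E n \<in> sets borel \<and> pos_var \<nu> (E n) = \<infinity>" for n
    by (induction n) (auto simp: E_def inf dest: nxt)
  have dec: "decseq E"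
    by (rule decseq_SucI) (use nxt E in \<open>auto simp: E_def\<close>)
  define D where "D n = E n - E (Suc n)" for n
  have D1: "\<bar>\<nu> (D n)\<bar> > 1" for n using nxt[of "E n"] E[of n] by (auto simp: D_def E_def)
  have dj: "D m \<inter> D n = {}" if "m < n" for m n
    using decseqD[OF dec, of "Suc m" n] that by (auto simp: D_def)
  have "disjoint_family D"
    unfolding disjoint_family_on_def using dj by (metis Int_commute linorder_neqE_nat)
  moreover have "range D \<subseteq> sets borel" using E by (auto simp: D_def)
  ultimately have "summable (\<lambda>n. \<nu> (D n))"
    using s unfolding signed_borel_measure_def by (blast intro: sums_summable)
  then have "(\<lambda>n. \<nu> (D n)) \<longlonglongrightarrow> 0" by (rule summable_LIMSEQ_zero)
  then have "\<forall>\<^sub>F n in sequentially. dist (\<nu> (D n)) 0 < 1"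
    by (rule tendstoD) simp
  then obtain n where "dist (\<nu> (D n)) 0 < 1"
    using eventually_happens trivial_limit_sequentially by blast
  then show False using D1[of n] by (simp add: dist_real_def)
qed

lemma signed_uminus: "signed_borel_measure \<nu> \<Longrightarrow> signed_borel_measure (\<lambda>A. - \<nu> A)"
  by (auto simp: signed_borel_measure_def intro!: sums_minus)

lemma finite_measure_pos_part:
  assumes s: "signed_borel_measure \<nu>"
  shows "finite_measure (pos_part \<nu>)"
proof (rule finite_measureI)
  have "space (pos_part \<nu>) = UNIV" by (simp add: pos_part_def space_measure_of_conv)
  then show "emeasure (pos_part \<nu>) (space (pos_part \<nu>)) \<noteq> \<infinity>"
    using pos_var_finite[OF s] by (simp add: emeasure_pos_part[OF s] less_top)
qed

lemma jordan_le:
  assumes s: "signed_borel_measure \<nu>" and A: "A \<in> sets borel"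
  shows "measure (pos_part \<nu>) A \<le> \<nu> A + measure (pos_part (\<lambda>A. - \<nu> A)) A"
proof -
  let ?q = "measure (pos_part (\<lambda>A. - \<nu> A)) A"
  note s' = signed_uminus[OF s]
  interpret P: finite_measure "pos_part \<nu>" by (rule finite_measure_pos_part[OF s])
  interpret N: finite_measure "pos_part (\<lambda>A. - \<nu> A)" by (rule finite_measure_pos_part[OF s'])
  have q: "ennreal ?q = pos_var (\<lambda>A. - \<nu> A) A"
    by (simp add: N.emeasure_eq_measure[symmetric] emeasure_pos_part[OF s' A])
  have up: "\<nu> B \<le> \<nu> A + ?q" if B: "B \<in> sets borel" "B \<subseteq> A" for B
  proof -
    have "\<nu> (B \<union> (A - B)) = \<nu> B + \<nu> (A - B)" using A B by (intro signed_Un[OF s]) auto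
    moreover have "B \<union> (A - B) = A" using B by auto
    moreover have "ennreal (- \<nu> (A - B)) \<le> ennreal ?q"
      unfolding q using A B by (intro pos_var_upper[where \<nu> = "\<lambda>A. - \<nu> A"]) auto
    then have "- \<nu> (A - B) \<le> ?q" by (simp add: ennreal_le_iff)
    ultimately show ?thesis by simp
  qed
  have "ennreal (measure (pos_part \<nu>) A) = pos_var \<nu> A"
    by (simp add: P.emeasure_eq_measure[symmetric] emeasure_pos_part[OF s A])
  also have "\<dots> \<le> ennreal (\<nu> A + ?q)"
    unfolding pos_var_def by (rule SUP_least) (auto intro!: ennreal_leI up)
  finally show ?thesis
    using up[of "{}"] by (simp add: ennreal_le_iff signed_empty[OF s])
qed

lemma jordan_decomposition:
  assumes s: "signed_borel_measure \<nu>" and A: "A \<in> sets borel"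
  shows "\<nu> A = measure (pos_part \<nu>) A - measure (pos_part (\<lambda>A. - \<nu> A)) A"
  using jordan_le[OF s A] jordan_le[OF signed_uminus[OF s] A] by simp

lemma complex_borel_measure_parts:
  assumes "complex_borel_measure \<mu>"
  shows "signed_borel_measure (\<lambda>A. Re (\<mu> A))" "signed_borel_measure (\<lambda>A. Im (\<mu> A))"
proof -
  have *: "(\<lambda>i. \<mu> (A i)) sums \<mu> (\<Union>i. A i)"
    if "range A \<subseteq> sets borel" "disjoint_family A" for A :: "nat \<Rightarrow> complex set"
    using assms that unfolding complex_borel_measure_def by blast
  show "signed_borel_measure (\<lambda>A. Re (\<mu> A))"
    unfolding signed_borel_measure_def by (intro allI impI sums_Re *)
  show "signed_borel_measure (\<lambda>A. Im (\<mu> A))"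
    unfolding signed_borel_measure_def by (intro allI impI sums_Im *)
qed

lemma cintegral_indicator:
  assumes "complex_borel_measure \<mu>" and A: "A \<in> sets borel"
  shows "cintegral \<mu> (indicator A) = \<mu> A"
proof -
  note s = complex_borel_measure_parts[OF assms(1)]
  have *: "(\<integral>z. indicator A z \<partial>pos_part \<nu>) = complex_of_real (measure (pos_part \<nu>) A)" for \<nu>
  proof -
    have "A \<inter> space (pos_part \<nu>) = A" by (simp add: pos_part_def space_measure_of_conv)
    moreover have "(\<integral>z. indicator A z \<partial>pos_part \<nu>)
        = (\<integral>z. complex_of_real (indicator A z) \<partial>pos_part \<nu>)"
      by (rule Bochner_Integration.integral_cong) (auto simp: indicator_def)
    ultimately show ?thesis by simp
  qed
  show ?thesis
    unfolding cintegral_def * complex_eq_iff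
    using jordan_decomposition[OF s(1) A] jordan_decomposition[OF s(2) A] by simp
qed

definition quasi_definite :: "(complex set \<Rightarrow> complex) \<Rightarrow> bool" where
  "quasi_definite \<mu> \<longleftrightarrow>
     (\<forall>n. Determinant.det
        (Matrix.mat (Suc n) (Suc n) (\<lambda>(i, j). cintegral \<mu> (\<lambda>z. z powi (int i - int j)))) \<noteq> 0)"

section \<open>Laurent polynomials\<close>

type_synonym laurent = "int \<Rightarrow>\<^sub>0 complex"

definition leval :: "laurent \<Rightarrow> complex \<Rightarrow> complex" where
  "leval f z = (\<Sum>k \<in> Poly_Mapping.keys f. Poly_Mapping.lookup f k * z powi k)"

definition lconj :: "laurent \<Rightarrow> laurent" where
  "lconj f = Poly_Mapping.map cnj f"

definition lscale :: "complex \<Rightarrow> laurent \<Rightarrow> laurent" where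
  "lscale c f = Poly_Mapping.map ((*) c) f"

lemma lookup_lscale: "Poly_Mapping.lookup (lscale c f) k = c * Poly_Mapping.lookup f k"
  by (simp add: lscale_def Poly_Mapping.map.rep_eq when_def)

global_interpretation laurent: vector_space lscale
  by unfold_locales
    (auto intro!: poly_mapping_eqI simp: lookup_lscale lookup_add algebra_simps)

(* The projection onto U along W, for complementary subspaces U and W. *)
definition proj_along :: "laurent set \<Rightarrow> laurent set \<Rightarrow> laurent \<Rightarrow> laurent" where
  "proj_along U W f = (THE g. g \<in> U \<and> f - g \<in> W)"

section \<open>Semi-infinite matrices and vectors\<close>

type_synonym smat = "nat \<Rightarrow> nat \<Rightarrow> complex"
type_synonym svec = "nat \<Rightarrow> complex"

(* In all products below the series have finitely many nonzero terms in their intended use. *)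
definition smat_mult :: "smat \<Rightarrow> smat \<Rightarrow> smat" (infixl "\<star>" 70) where
  "A \<star> B = (\<lambda>i j. suminf (\<lambda>k. A i k * B k j))"

definition mat_col :: "smat \<Rightarrow> svec \<Rightarrow> svec" (infixr "\<star>\<^sub>c" 70) where
  "A \<star>\<^sub>c v = (\<lambda>i. suminf (\<lambda>k. A i k * v k))"

definition row_mat :: "svec \<Rightarrow> smat \<Rightarrow> svec" (infixl "\<star>\<^sub>r" 70) where
  "v \<star>\<^sub>r A = (\<lambda>j. suminf (\<lambda>k. v k * A k j))"

definition row_col :: "svec \<Rightarrow> svec \<Rightarrow> complex" (infix "\<star>\<^sub>v" 65) where
  "v \<star>\<^sub>v w = suminf (\<lambda>k. v k * w k)"

definition munit :: "nat \<Rightarrow> nat \<Rightarrow> smat" where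
  "munit a b = (\<lambda>i j. of_bool (i = a \<and> j = b))"

definition sident :: smat where
  "sident = (\<lambda>i j. of_bool (i = j))"

definition stransp :: "smat \<Rightarrow> smat" where
  "stransp A = (\<lambda>i j. A j i)"

definition sdagger :: "smat \<Rightarrow> smat" where
  "sdagger A = (\<lambda>i j. cnj (A j i))"

definition vdagger :: "svec \<Rightarrow> svec" where
  "vdagger v = (\<lambda>i. cnj (v i))"

primrec spower :: "smat \<Rightarrow> nat \<Rightarrow> smat" where
  "spower A 0 = sident"
| "spower A (Suc k) = A \<star> spower A k"

(* Unique for triangular matrices with nonzero diagonal, the only ones it is applied to. *)
definition sinv :: "smat \<Rightarrow> smat" where
  "sinv A = (THE B. A \<star> B = sident \<and> B \<star> A = sident)"

(* Blocks keep their original indices and are padded with zeros, so that products of blocks are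
   products of semi-infinite matrices. *)
definition block :: "nat set \<Rightarrow> nat set \<Rightarrow> smat \<Rightarrow> smat" where
  "block I J A = (\<lambda>i j. if i \<in> I \<and> j \<in> J then A i j else 0)"

definition vblock :: "nat set \<Rightarrow> svec \<Rightarrow> svec" where
  "vblock I v = (\<lambda>i. if i \<in> I then v i else 0)"

(* The inverse of the l x l leading block, again padded with zeros. *)
definition block_inv :: "nat \<Rightarrow> smat \<Rightarrow> smat" where
  "block_inv l A = (\<lambda>i j. if i < l \<and> j < l
     then the (mat_inverse (Matrix.mat l l (\<lambda>(i, j). A i j))) $$ (i, j) else 0)"

section \<open>Gauss factorization\<close>

definition gauss_factorization :: "smat \<Rightarrow> smat \<Rightarrow> smat \<Rightarrow> bool" where
  "gauss_factorization g S1 S2 \<longleftrightarrow>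
     (\<forall>i j. i < j \<longrightarrow> S1 i j = 0) \<and> (\<forall>i. S1 i i = 1) \<and>
     (\<forall>i j. j < i \<longrightarrow> S2 i j = 0) \<and>
     g = sinv S1 \<star> S2"

definition gauss_lower :: "smat \<Rightarrow> smat" where
  "gauss_lower g = (THE S1. \<exists>S2. gauss_factorization g S1 S2)"

definition gauss_upper :: "smat \<Rightarrow> smat" where
  "gauss_upper g = (THE S2. \<exists>S1. gauss_factorization g S1 S2)"

section \<open>Extended ordering and biorthogonal Laurent polynomials\<close>

(* The exponent of the j-th entry of chi: each period of length np + nm lists the next np
   non-negative powers and then the next nm negative powers. Every integer occurs iff np and nm are
   both positive; only then do the splittings below cover all Laurent polynomials and does
   Upsilon chi(z) = z chi(z) hold. *)
definition chi_exp :: "nat \<Rightarrow> nat \<Rightarrow> nat \<Rightarrow> int" where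
  "chi_exp np nm j =
     (let q = j div (np + nm); r = j mod (np + nm)
      in if r < np then int (q * np + r) else - int (q * nm + (r - np)) - 1)"

definition chi :: "nat \<Rightarrow> nat \<Rightarrow> nat \<Rightarrow> laurent" where
  "chi np nm j = Poly_Mapping.single (chi_exp np nm j) 1"

definition chi_vec :: "nat \<Rightarrow> nat \<Rightarrow> complex \<Rightarrow> svec" where
  "chi_vec np nm z = (\<lambda>j. leval (chi np nm j) z)"

definition gram :: "(complex set \<Rightarrow> complex) \<Rightarrow> nat \<Rightarrow> nat \<Rightarrow> smat" where
  "gram \<mu> np nm = (\<lambda>i j. cintegral \<mu> (\<lambda>z. chi_vec np nm z i * cnj (chi_vec np nm z j)))"

(* Entries of A chi as Laurent polynomials, for a matrix A with finite rows. *)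
definition apply_chi :: "smat \<Rightarrow> nat \<Rightarrow> nat \<Rightarrow> nat \<Rightarrow> laurent" where
  "apply_chi A np nm k = (\<Sum>j | A k j \<noteq> 0. lscale (A k j) (chi np nm j))"

definition phi1 :: "(complex set \<Rightarrow> complex) \<Rightarrow> nat \<Rightarrow> nat \<Rightarrow> nat \<Rightarrow> laurent" where
  "phi1 \<mu> np nm = apply_chi (gauss_lower (gram \<mu> np nm)) np nm"

definition phi2 :: "(complex set \<Rightarrow> complex) \<Rightarrow> nat \<Rightarrow> nat \<Rightarrow> nat \<Rightarrow> laurent" where
  "phi2 \<mu> np nm = apply_chi (sdagger (sinv (gauss_upper (gram \<mu> np nm)))) np nm"

definition CD_kernel ::
  "(complex set \<Rightarrow> complex) \<Rightarrow> nat \<Rightarrow> nat \<Rightarrow> nat \<Rightarrow> complex \<Rightarrow> complex \<Rightarrow> complex" where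
  "CD_kernel \<mu> np nm l z z' =
     (\<Sum>k<l. leval (phi1 \<mu> np nm k) z' * leval (lconj (phi2 \<mu> np nm k)) (cnj z))"

section \<open>Projections\<close>

definition Lam :: "nat \<Rightarrow> nat \<Rightarrow> nat \<Rightarrow> laurent set" where
  "Lam np nm l = laurent.span (chi np nm ` {..<l})"

definition perp1 :: "(complex set \<Rightarrow> complex) \<Rightarrow> nat \<Rightarrow> nat \<Rightarrow> nat \<Rightarrow> laurent set" where
  "perp1 \<mu> np nm l = laurent.span (phi2 \<mu> np nm ` {l..})"

definition perp2 :: "(complex set \<Rightarrow> complex) \<Rightarrow> nat \<Rightarrow> nat \<Rightarrow> nat \<Rightarrow> laurent set" where
  "perp2 \<mu> np nm l = laurent.span (phi1 \<mu> np nm ` {l..})"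

(* By biorthogonality f |-> (z' |-> integral of K(z,z') f(z)) is the sum over k < l of
   <f, phi2 k> phi1 k, which annihilates phi1 k for k \<ge> l: K(z,z') is the kernel of the
   projection along perp2, that is of proj2, and the conjugate formula belongs to proj1.
   The opposite pairing fails for non-real measures: for d mu = (1 + z/2) d theta / (2 pi),
   np = nm = l = 1 and f = 1/z the integral is 1/2, whereas proj1 f = 0. *)
definition proj1 :: "(complex set \<Rightarrow> complex) \<Rightarrow> nat \<Rightarrow> nat \<Rightarrow> nat \<Rightarrow> laurent \<Rightarrow> laurent" where
  "proj1 \<mu> np nm l = proj_along (Lam np nm l) (perp1 \<mu> np nm l)"

definition proj2 :: "(complex set \<Rightarrow> complex) \<Rightarrow> nat \<Rightarrow> nat \<Rightarrow> nat \<Rightarrow> laurent \<Rightarrow> laurent" where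
  "proj2 \<mu> np nm l = proj_along (Lam np nm l) (perp2 \<mu> np nm l)"

section \<open>Shift matrix\<close>

definition e1 :: "nat \<Rightarrow> nat \<Rightarrow> nat \<Rightarrow> svec" where
  "e1 np nm k = (\<lambda>j. of_bool (chi_exp np nm j = int k))"

definition e2 :: "nat \<Rightarrow> nat \<Rightarrow> nat \<Rightarrow> svec" where
  "e2 np nm k = (\<lambda>j. of_bool (chi_exp np nm j = - int k - 1))"

definition Lambda1 :: "nat \<Rightarrow> nat \<Rightarrow> smat" where
  "Lambda1 np nm = (\<lambda>i j. suminf (\<lambda>k. e1 np nm k i * e1 np nm (Suc k) j))"

definition Lambda2 :: "nat \<Rightarrow> nat \<Rightarrow> smat" where
  "Lambda2 np nm = (\<lambda>i j. suminf (\<lambda>k. e2 np nm k i * e2 np nm (Suc k) j))"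

definition Lambda :: smat where
  "Lambda = (\<lambda>i j. suminf (\<lambda>k. munit k (Suc k) i j))"

definition Upsilon :: "nat \<Rightarrow> nat \<Rightarrow> smat" where
  "Upsilon np nm = (\<lambda>i j. Lambda1 np nm i j + stransp (Lambda2 np nm) i j
      + (munit np np \<star> spower (stransp Lambda) np) i j)"

end

theory Submission
  imports Defs
begin

text \<open>
  Everything rests on the fact that the entries of the moment matrix g depend on differences of
  exponents only (\<open>gram_moment\<close>).  The exponents of the first l entries of the extended ordering fill
  an interval of integers, so the l-th leading block of g is a Toeplitz matrix up to a common
  permutation of rows and columns, and quasi-definiteness makes it invertible
  (\<open>gram_blocks_invertible\<close>).  By forward elimination this is
  enough for a unique Gauss factorization g = S^-1 U with a non-vanishing diagonal of U
  (\<open>gauss_factors\<close>, \<open>gauss_upper_diag\<close>).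

  Put T = U^-1.  The relation S g T = 1 says that the two families of Laurent polynomials are
  biorthogonal (\<open>biorthogonal\<close>).  Hence pairing with one family gives the coefficient functionals of
  the other one, and truncating the expansion after l terms is the projection
  (\<open>proj_along_dual_family\<close>); the truncated expansion is integration against the kernel.  The
  reproducing property is biorthogonality once more.  The relation T (S g) = 1, restricted to the first
  l indices, identifies the coefficient matrix T S of the kernel with the inverse of the leading block
  (\<open>CD_kernel_block_inv\<close>).

  If both kinds of powers occur, the shift matrix is the permutation matrix that raises the exponent
  by one (\<open>Upsilon_entry\<close>).  Raising both exponents by one leaves the entries of g unchanged, so the
  shift commutes with g.  The formula for (z' - 1 / cnj z) K follows from that: the failure of the leading
  block to commute with the shift comes only from the off-diagonal blocks, which is what the right-hand
  side records (\<open>CD_kernel_shift\<close>).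

  The integrals are finite combinations of integrals of functions that are bounded on the circle, where
  the measure lives; so they are linear and depend on the values on the circle only.
\<close>

section \<open>Integration over the circle\<close>

text \<open>
  Powers z powi k with k < 0 are unbounded near 0, so boundedness is demanded on the circle only;
  measurability is demanded everywhere because the integrals run over the whole plane.
\<close>

definition circle_bounded :: "(complex \<Rightarrow> complex) \<Rightarrow> bool" where
  "circle_bounded h \<longleftrightarrow> h \<in> borel_measurable borel \<and> (\<exists>B. \<forall>z\<in>sphere 0 1. norm (h z) \<le> B)"

lemma circle_bounded_const [simp]: "circle_bounded (\<lambda>_. c)"
  by (auto simp: circle_bounded_def)

lemma circle_bounded_add:
  assumes "circle_bounded f" "circle_bounded h"
  shows "circle_bounded (\<lambda>z. f z + h z)"
proof -
  obtain A B where "\<forall>z\<in>sphere 0 1. norm (f z) \<le> A" "\<forall>z\<in>sphere 0 1. norm (h z) \<le> B"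
    using assms by (auto simp: circle_bounded_def)
  then have "\<forall>z\<in>sphere 0 1. norm (f z + h z) \<le> A + B"
    by (meson add_mono norm_triangle_le)
  moreover have "(\<lambda>z. f z + h z) \<in> borel_measurable borel"
    using assms by (auto simp: circle_bounded_def)
  ultimately show ?thesis unfolding circle_bounded_def by blast
qed

lemma circle_bounded_mult:
  assumes "circle_bounded f" "circle_bounded h"
  shows "circle_bounded (\<lambda>z. f z * h z)"
proof -
  obtain A B where AB: "\<forall>z\<in>sphere 0 1. norm (f z) \<le> A" "\<forall>z\<in>sphere 0 1. norm (h z) \<le> B"
    using assms by (auto simp: circle_bounded_def)
  have "norm (f z * h z) \<le> A * B" if "z \<in> sphere 0 1" for z
    unfolding norm_mult using AB that by (intro mult_mono) (auto intro: order_trans[OF norm_ge_zero])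
  moreover have "(\<lambda>z. f z * h z) \<in> borel_measurable borel"
    using assms by (auto simp: circle_bounded_def)
  ultimately show ?thesis unfolding circle_bounded_def by blast
qed

lemma circle_bounded_cnj:
  assumes "circle_bounded f"
  shows "circle_bounded (\<lambda>z. cnj (f z))"
proof -
  have "(\<lambda>z. cnj (f z)) \<in> borel_measurable borel"
    by (rule borel_measurable_continuous_on[of cnj])
      (use assms in \<open>auto simp: circle_bounded_def intro: continuous_intros\<close>)
  then show ?thesis using assms by (auto simp: circle_bounded_def)
qed

lemma circle_bounded_sum:
  "(\<And>i. i \<in> I \<Longrightarrow> circle_bounded (f i)) \<Longrightarrow> circle_bounded (\<lambda>z. \<Sum>i\<in>I. f i z)"
  by (induction I rule: infinite_finite_induct) (auto intro: circle_bounded_add)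

lemma circle_bounded_powi: "circle_bounded (\<lambda>z. z powi k)"
proof -
  have "(\<lambda>z::complex. z powi k) \<in> borel_measurable borel"
    by (cases "k \<ge> 0") (auto simp: power_int_def)
  moreover have "\<forall>z\<in>sphere 0 1. norm (z powi k :: complex) \<le> 1"
    by (simp add: norm_power_int)
  ultimately show ?thesis unfolding circle_bounded_def by blast
qed

lemma circle_bounded_leval: "circle_bounded (leval f)"
  unfolding leval_def[abs_def]
  by (intro circle_bounded_sum circle_bounded_mult circle_bounded_powi circle_bounded_const)

lemma sets_pos_part [simp]: "sets (pos_part \<nu>) = sets borel"
  using sets.sigma_sets_eq[of "borel :: complex measure"] by (simp add: pos_part_def)

text \<open>
  The positive part of a real measure takes its values from subsets of the given set, so it
  inherits the vanishing off the circle.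
\<close>

lemma AE_pos_part_circle:
  assumes s: "signed_borel_measure \<nu>"
    and supp: "\<And>A. A \<in> sets borel \<Longrightarrow> A \<inter> sphere 0 1 = {} \<Longrightarrow> \<nu> A = 0"
  shows "AE z in pos_part \<nu>. z \<in> sphere 0 1"
proof (rule AE_I)
  let ?N = "- sphere (0::complex) 1"
  have N: "?N \<in> sets borel" by (simp add: borel_closed)
  have "pos_var \<nu> ?N = 0"
    unfolding pos_var_def
  proof (intro antisym SUP_least)
    fix B assume "B \<in> {B \<in> sets borel. B \<subseteq> ?N}"
    then have "\<nu> B = 0" by (intro supp) auto
    then show "ennreal (\<nu> B) \<le> 0" by simp
  qed simp
  then show "emeasure (pos_part \<nu>) ?N = 0" by (simp only: emeasure_pos_part[OF s N])
  show "?N \<in> sets (pos_part \<nu>)" using N by simp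
qed auto

lemma integrable_pos_part:
  assumes s: "signed_borel_measure \<nu>"
    and supp: "\<And>A. A \<in> sets borel \<Longrightarrow> A \<inter> sphere 0 1 = {} \<Longrightarrow> \<nu> A = 0"
    and h: "circle_bounded h"
  shows "integrable (pos_part \<nu>) h"
proof -
  interpret finite_measure "pos_part \<nu>" by (rule finite_measure_pos_part[OF s])
  obtain B where B: "\<forall>z\<in>sphere 0 1. norm (h z) \<le> B" and "h \<in> borel_measurable borel"
    using h by (auto simp: circle_bounded_def)
  then have "h \<in> borel_measurable (pos_part \<nu>)"
    using measurable_cong_sets[OF sets_pos_part refl] by blast
  moreover have "AE z in pos_part \<nu>. norm (h z) \<le> B"
    using AE_pos_part_circle[OF s supp] B by (auto elim!: eventually_mono)
  ultimately show ?thesis by (intro integrable_const_bound[where B=B])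
qed

locale circle_measure =
  fixes \<mu> :: "complex set \<Rightarrow> complex"
  assumes complex_measure: "complex_borel_measure \<mu>" and on_circle: "supported_on_circle \<mu>"
begin

lemma signed_parts:
  "signed_borel_measure (\<lambda>A. Re (\<mu> A))" "signed_borel_measure (\<lambda>A. - Re (\<mu> A))"
  "signed_borel_measure (\<lambda>A. Im (\<mu> A))" "signed_borel_measure (\<lambda>A. - Im (\<mu> A))"
  using complex_borel_measure_parts[OF complex_measure] signed_uminus by auto

lemma zero_off_circle:
  "A \<in> sets borel \<Longrightarrow> A \<inter> sphere 0 1 = {} \<Longrightarrow> \<mu> A = 0"
  using on_circle by (auto simp: supported_on_circle_def)

lemma integrable_parts:
  assumes "circle_bounded h"
  shows "integrable (pos_part (\<lambda>A. Re (\<mu> A))) h" "integrable (pos_part (\<lambda>A. - Re (\<mu> A))) h"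
    "integrable (pos_part (\<lambda>A. Im (\<mu> A))) h" "integrable (pos_part (\<lambda>A. - Im (\<mu> A))) h"
  by (intro integrable_pos_part signed_parts assms; simp add: zero_off_circle)+

lemma cintegral_add:
  assumes "circle_bounded f" "circle_bounded h"
  shows "cintegral \<mu> (\<lambda>z. f z + h z) = cintegral \<mu> f + cintegral \<mu> h"
  unfolding cintegral_def
  by (simp add: integrable_parts[OF assms(1)] integrable_parts[OF assms(2)] algebra_simps)

lemma cintegral_scale:
  assumes "circle_bounded h"
  shows "cintegral \<mu> (\<lambda>z. c * h z) = c * cintegral \<mu> h"
  unfolding cintegral_def by (simp add: algebra_simps)

lemma cintegral_sum:
  assumes "\<And>i. i \<in> I \<Longrightarrow> circle_bounded (h i)"
  shows "cintegral \<mu> (\<lambda>z. \<Sum>i\<in>I. c i * h i z) = (\<Sum>i\<in>I. c i * cintegral \<mu> (h i))"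
  using assms
proof (induction I rule: infinite_finite_induct)
  case (insert i I)
  then have "circle_bounded (\<lambda>z. \<Sum>i\<in>I. c i * h i z)" "circle_bounded (\<lambda>z. c i * h i z)"
    by (auto intro!: circle_bounded_sum circle_bounded_mult)
  with insert show ?case by (simp add: cintegral_add cintegral_scale)
qed (simp_all add: cintegral_def)

lemma cintegral_cong_circle:
  assumes "circle_bounded f" "circle_bounded h" "\<And>z. norm z = 1 \<Longrightarrow> f z = h z"
  shows "cintegral \<mu> f = cintegral \<mu> h"
proof -
  have *: "(\<integral>z. f z \<partial>pos_part \<nu>) = (\<integral>z. h z \<partial>pos_part \<nu>)"
    if s: "signed_borel_measure \<nu>"
    and supp: "\<And>A. A \<in> sets borel \<Longrightarrow> A \<inter> sphere 0 1 = {} \<Longrightarrow> \<nu> A = 0" for \<nu>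
  proof (rule integral_cong_AE)
    show "AE z in pos_part \<nu>. f z = h z"
      using AE_pos_part_circle[OF s supp] assms(3) by (auto elim!: eventually_mono)
  qed (use assms integrable_pos_part[OF s supp] borel_measurable_integrable in blast)+
  show ?thesis
    unfolding cintegral_def by (simp add: * signed_parts zero_off_circle)
qed

end

section \<open>Triangular semi-infinite matrices\<close>

definition lower_tri :: "smat \<Rightarrow> bool" where
  "lower_tri A \<longleftrightarrow> (\<forall>i j. i < j \<longrightarrow> A i j = 0)"

lemma lower_tri_mult_entry:
  assumes "lower_tri A" "i < n"
  shows "(A \<star> B) i j = (\<Sum>k<n. A i k * B k j)"
  unfolding smat_mult_def
  by (rule suminf_finite) (use assms in \<open>auto simp: lower_tri_def\<close>)

lemma lower_tri_mult:
  assumes A: "lower_tri A" and B: "lower_tri B"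
  shows "lower_tri (A \<star> B)"
  unfolding lower_tri_def
proof (intro allI impI)
  fix i j :: nat assume "i < j"
  then show "(A \<star> B) i j = 0"
    using B by (subst lower_tri_mult_entry[OF A, of i "Suc i"]) (auto simp: lower_tri_def intro!: sum.neutral)
qed

text \<open>
  For general semi-infinite matrices associativity fails, because the sums over the two inner
  indices need not be interchangeable.  Lower triangular factors on the left make every entry of
  the product a finite sum.
\<close>

lemma lower_tri_mult_assoc:
  assumes A: "lower_tri A" and B: "lower_tri B"
  shows "(A \<star> B) \<star> C = A \<star> (B \<star> C)"
proof (intro ext)
  fix i j :: nat
  let ?n = "Suc i"
  have "((A \<star> B) \<star> C) i j = (\<Sum>k<?n. (\<Sum>m<?n. A i m * B m k) * C k j)"
    by (simp only: lower_tri_mult_entry[OF lower_tri_mult[OF A B], of i ?n] lower_tri_mult_entry[OF A, of i ?n]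
      lessI)
  also have "\<dots> = (\<Sum>m<?n. A i m * (\<Sum>k<?n. B m k * C k j))"
    unfolding sum_distrib_left sum_distrib_right by (subst sum.swap) (simp only: mult.assoc)
  also have "\<dots> = (\<Sum>m<?n. A i m * (B \<star> C) m j)"
    by (intro sum.cong refl arg_cong2[where f="(*)"] lower_tri_mult_entry[OF B, symmetric]) simp
  also have "\<dots> = (A \<star> (B \<star> C)) i j"
    by (rule lower_tri_mult_entry[OF A, symmetric]) simp
  finally show "((A \<star> B) \<star> C) i j = (A \<star> (B \<star> C)) i j" .
qed

lemma lower_tri_sident: "lower_tri sident"
  by (simp add: lower_tri_def sident_def)

lemma sident_mult [simp]: "sident \<star> A = A"
  by (intro ext, subst lower_tri_mult_entry[OF lower_tri_sident lessI])
    (simp add: sident_def)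

lemma mult_sident [simp]: "A \<star> sident = A"
proof (intro ext)
  fix i j :: nat
  have "(A \<star> sident) i j = (\<Sum>k\<in>{j}. A i k * sident k j)"
    unfolding smat_mult_def by (rule suminf_finite) (auto simp: sident_def)
  then show "(A \<star> sident) i j = A i j" by (simp add: sident_def)
qed

lemma stransp_mult: "stransp (A \<star> B) = stransp B \<star> stransp A"
  by (simp add: stransp_def smat_mult_def mult.commute)

lemma stransp_sident [simp]: "stransp sident = sident"
  by (auto simp: stransp_def sident_def fun_eq_iff)

lemma stransp_stransp [simp]: "stransp (stransp A) = A"
  by (simp add: stransp_def)

text \<open>
  Forward substitution: row i of a left inverse is the i-th unit row vector minus the combination
  of the earlier rows that cancels the entries of A to the left of the diagonal, divided by the
  diagonal entry.
\<close>

lemma lower_tri_left_inverse_row: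
  assumes A: "lower_tri A" and d: "\<And>i. A i i \<noteq> 0"
  shows "\<exists>b. (\<forall>k>i. b k = 0) \<and> b i = inverse (A i i) \<and> (\<forall>j. (\<Sum>k\<le>i. b k * A k j) = of_bool (i = j))"
proof (induction i rule: less_induct)
  case (less i)
  then obtain b where
    b: "\<And>m. m < i \<Longrightarrow> (\<forall>k>m. b m k = 0) \<and> (\<forall>j. (\<Sum>k\<le>m. b m k * A k j) = of_bool (m = j))"
    by metis
  define c where "c k = (if k = i then inverse (A i i) else if k < i then - (\<Sum>m<i. A i m / A i i * b m k) else 0)" for k
  have "(\<Sum>k\<le>i. c k * A k j) = of_bool (i = j)" for j
  proof -
    have "(\<Sum>k<i. c k * A k j) = - (\<Sum>k<i. \<Sum>m<i. A i m / A i i * b m k * A k j)"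
      by (simp add: c_def sum_distrib_right sum_negf)
    also have "\<dots> = - (\<Sum>m<i. A i m / A i i * (\<Sum>k<i. b m k * A k j))"
      by (subst sum.swap) (simp add: sum_distrib_left mult.assoc)
    also have "\<dots> = - (\<Sum>m<i. A i m / A i i * of_bool (m = j))"
    proof (intro arg_cong[where f=uminus] sum.cong refl arg_cong2[where f="(*)"])
      fix m assume m: "m \<in> {..<i}"
      then have "(\<Sum>k<i. b m k * A k j) = (\<Sum>k\<le>m. b m k * A k j)"
        by (intro sum.mono_neutral_right) (use b[of m] in auto)
      then show "(\<Sum>k<i. b m k * A k j) = of_bool (m = j)" using b[of m] m by auto
    qed
    also have "\<dots> = - (if j < i then A i j / A i i else 0)"
      by (simp add: of_bool_def if_distrib sum.delta cong: if_cong)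
    finally show ?thesis
      using A d[of i] by (cases j i rule: linorder_cases) (auto simp: lessThan_Suc_atMost[symmetric] c_def lower_tri_def divide_inverse)
  qed
  then show ?case by (intro exI[of _ c]) (auto simp: c_def)
qed

lemma lower_tri_left_inverse:
  assumes A: "lower_tri A" and d: "\<And>i. A i i \<noteq> 0"
  obtains B where "lower_tri B" "\<And>i. B i i = inverse (A i i)" "B \<star> A = sident"
proof -
  obtain B where B: "\<And>i. (\<forall>k>i. B i k = 0) \<and> B i i = inverse (A i i) \<and>
      (\<forall>j. (\<Sum>k\<le>i. B i k * A k j) = of_bool (i = j))"
    using lower_tri_left_inverse_row[OF assms] by metis
  then have L: "lower_tri B" by (simp add: lower_tri_def)
  have "(B \<star> A) i j = sident i j" for i j
    using B by (subst lower_tri_mult_entry[OF L lessI]) (simp add: lessThan_Suc_atMost sident_def)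
  then show ?thesis using that[OF L] B by blast
qed

lemma lower_tri_inverse_unique:
  assumes B: "lower_tri B" "B \<star> A = sident" and A: "lower_tri A" and X: "A \<star> X = sident"
  shows "X = B"
proof -
  have "B \<star> (A \<star> X) = X" by (simp add: lower_tri_mult_assoc[OF B(1) A, symmetric] B)
  with X show ?thesis by simp
qed

text \<open>
  The left inverse B is again lower triangular with non-zero diagonal, so it has a left inverse C
  itself, and C = C (B A) = (C B) A = A shows that B is also a right inverse.
\<close>

lemma lower_tri_inverse:
  assumes A: "lower_tri A" and d: "\<And>i. A i i \<noteq> 0"
  shows "lower_tri (sinv A) \<and> (\<forall>i. sinv A i i = inverse (A i i)) \<and> A \<star> sinv A = sident \<and> sinv A \<star> A = sident"
proof -
  obtain B where B: "lower_tri B" "\<And>i. B i i = inverse (A i i)" "B \<star> A = sident"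
    using lower_tri_left_inverse[OF A d] by blast
  obtain C where C: "lower_tri C" "C \<star> B = sident"
    using lower_tri_left_inverse[OF B(1)] B(2) d by (metis nonzero_imp_inverse_nonzero)
  have "C = C \<star> (B \<star> A)" using B by simp
  also have "\<dots> = A" by (simp add: lower_tri_mult_assoc[OF C(1) B(1), symmetric] C)
  finally have AB: "A \<star> B = sident" using C by simp
  have "sinv A = B"
    unfolding sinv_def
    by (rule the_equality) (use AB B(3) lower_tri_inverse_unique[OF B(1,3) A] in blast)+
  with AB B show ?thesis by simp
qed

definition upper_tri :: "smat \<Rightarrow> bool" where
  "upper_tri A \<longleftrightarrow> (\<forall>i j. j < i \<longrightarrow> A i j = 0)"

lemma upper_tri_mult_entry:
  assumes "upper_tri B" "j < n"
  shows "(A \<star> B) i j = (\<Sum>k<n. A i k * B k j)"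
  unfolding smat_mult_def
  by (rule suminf_finite) (use assms in \<open>auto simp: upper_tri_def\<close>)

lemma upper_tri_inverse:
  assumes A: "upper_tri A" and d: "\<And>i. A i i \<noteq> 0"
  shows "upper_tri (sinv A) \<and> (\<forall>i. sinv A i i = inverse (A i i)) \<and> A \<star> sinv A = sident \<and> sinv A \<star> A = sident"
proof -
  let ?V = "stransp A"
  have V: "lower_tri ?V" "\<And>i. ?V i i \<noteq> 0"
    using A d by (auto simp: lower_tri_def upper_tri_def stransp_def)
  note I = lower_tri_inverse[OF V]
  let ?X = "stransp (sinv ?V)"
  have "stransp (sinv ?V \<star> ?V) = sident" "stransp (?V \<star> sinv ?V) = sident" using I by simp_all
  then have X: "A \<star> ?X = sident" "?X \<star> A = sident" by (simp_all add: stransp_mult)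
  have "sinv A = ?X"
    unfolding sinv_def[of A]
  proof (rule the_equality)
    fix Y assume "A \<star> Y = sident \<and> Y \<star> A = sident"
    then have "stransp (Y \<star> A) = sident" by simp
    then have "?V \<star> stransp Y = sident" by (simp add: stransp_mult)
    then have "stransp Y = sinv ?V" using lower_tri_inverse_unique I V by blast
    then show "Y = ?X" by (metis stransp_stransp)
  qed (use X in simp)
  with I X show ?thesis by (auto simp: upper_tri_def lower_tri_def stransp_def)
qed

section \<open>Gauss factorization\<close>

text \<open>
  Invertibility of all leading blocks is stated with finite sums, the form in which it is used below,
  instead of with determinants of matrices of varying dimension.
\<close>

definition blocks_invertible :: "smat \<Rightarrow> bool" where
  "blocks_invertible g \<longleftrightarrow>
     (\<forall>l. \<exists>H. \<forall>i<l. \<forall>j<l. (\<Sum>k<l. g i k * H k j) = of_bool (i = j) \<and> (\<Sum>k<l. H i k * g k j) = of_bool (i = j))"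

lemma block_inv:
  assumes g: "blocks_invertible g" and ij: "i < l" "j < l"
  shows "(\<Sum>k<l. g i k * block_inv l g k j) = of_bool (i = j)"
    and "(\<Sum>k<l. block_inv l g i k * g k j) = of_bool (i = j)"
proof -
  let ?M = "Matrix.mat l l (\<lambda>(i, j). g i j)"
  obtain H where H: "\<forall>i<l. \<forall>j<l. (\<Sum>k<l. g i k * H k j) = of_bool (i = j) \<and> (\<Sum>k<l. H i k * g k j) = of_bool (i = j)"
    using g unfolding blocks_invertible_def by blast
  let ?H = "Matrix.mat l l (\<lambda>(i, j). H i j)"
  have M: "?M \<in> carrier_mat l l" "?H \<in> carrier_mat l l" by auto
  have "?M * ?H = 1\<^sub>m l" "?H * ?M = 1\<^sub>m l"
    using H by (auto intro!: eq_matI simp: scalar_prod_def atLeast0LessThan)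
  then have "?M \<in> Units (ring_mat TYPE(complex) l ())"
    using M by (auto simp: Units_def ring_mat_def)
  then obtain B where B: "mat_inverse ?M = Some B"
    using mat_inverse(1)[OF M(1), where b="()"] by (cases "mat_inverse ?M") auto
  then have BM: "?M * B = 1\<^sub>m l" "B * ?M = 1\<^sub>m l" "B \<in> carrier_mat l l"
    using mat_inverse(2)[OF M(1)] by auto
  have E: "block_inv l g i j = B $$ (i, j)" if "i < l" "j < l" for i j
    using that B by (simp add: block_inv_def)
  have "(?M * B) $$ (i, j) = (\<Sum>k<l. g i k * block_inv l g k j)"
       "(B * ?M) $$ (i, j) = (\<Sum>k<l. block_inv l g i k * g k j)"
    using ij BM(3) by (auto simp: scalar_prod_def atLeast0LessThan E intro!: sum.cong)
  with BM(1,2) ij show "(\<Sum>k<l. g i k * block_inv l g k j) = of_bool (i = j)"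
    "(\<Sum>k<l. block_inv l g i k * g k j) = of_bool (i = j)" by auto
qed

lemma sum_of_bool_mult_right:
  fixes f :: "nat \<Rightarrow> complex"
  assumes "j < l" shows "(\<Sum>i<l. f i * of_bool (i = j)) = f j"
proof -
  have "(\<Sum>i<l. f i * of_bool (i = j)) = (\<Sum>i<l. if i = j then f i else 0)"
    by (intro sum.cong) auto
  then show ?thesis using assms by simp
qed

lemma sum_of_bool_mult_left:
  fixes f :: "nat \<Rightarrow> complex"
  assumes "i < l" shows "(\<Sum>j<l. of_bool (i = j) * f j) = f i"
proof -
  have "(\<Sum>j<l. of_bool (i = j) * f j) = (\<Sum>j<l. if j = i then f j else 0)"
    by (intro sum.cong) auto
  then show ?thesis using assms by simp
qed

lemma row_times_block_inv:
  assumes g: "blocks_invertible g" and "m < l"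
  shows "(\<Sum>i<l. (\<Sum>j<l. v j * g j i) * block_inv l g i m) = v m"
proof -
  have "(\<Sum>i<l. (\<Sum>j<l. v j * g j i) * block_inv l g i m)
      = (\<Sum>j<l. v j * (\<Sum>i<l. g j i * block_inv l g i m))"
    unfolding sum_distrib_left sum_distrib_right by (subst sum.swap) (simp only: mult.assoc)
  also have "\<dots> = (\<Sum>j<l. v j * of_bool (j = m))"
    using assms by (intro sum.cong refl) (simp add: block_inv)
  finally show ?thesis using assms by (simp add: sum_of_bool_mult_right)
qed

lemma block_row_zero:
  assumes "blocks_invertible g" "\<And>i. i < l \<Longrightarrow> (\<Sum>j<l. v j * g j i) = 0" "m < l"
  shows "v m = 0"
  using row_times_block_inv[OF assms(1,3), of v] assms(2) by simp

lemma block_inv_unique: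
  assumes g: "blocks_invertible g"
    and M: "\<And>i j. i < l \<Longrightarrow> j < l \<Longrightarrow> (\<Sum>k<l. M i k * g k j) = of_bool (i = j)"
    and ij: "i < l" "j < l"
  shows "block_inv l g i j = M i j"
  using block_row_zero[OF g, of l "\<lambda>k. block_inv l g i k - M i k" j] ij
  by (simp add: left_diff_distrib sum_subtractf block_inv[OF g] M)

text \<open>
  Multiplying by the inverse of the lower factor frees the definition from \<^const>\<open>sinv\<close>: a
  factorization is a unitriangular S1 for which S1 g is upper triangular.
\<close>

lemma gauss_factorization_iff:
  "gauss_factorization g S1 S2 \<longleftrightarrow>
     lower_tri S1 \<and> (\<forall>i. S1 i i = 1) \<and> upper_tri S2 \<and> S1 \<star> g = S2" (is "?L \<longleftrightarrow> ?R")
proof (cases "lower_tri S1 \<and> (\<forall>i. S1 i i = 1)")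
  case True
  then have S: "lower_tri S1" "\<And>i. S1 i i \<noteq> 0" by auto
  note I = lower_tri_inverse[OF S]
  have "g = sinv S1 \<star> S2 \<longleftrightarrow> S1 \<star> g = S2"
  proof
    assume g: "g = sinv S1 \<star> S2"
    have "S1 \<star> g = (S1 \<star> sinv S1) \<star> S2" 
      using I S by (subst g, subst lower_tri_mult_assoc) simp_all
    then show "S1 \<star> g = S2" using I by simp
  next
    assume g: "S1 \<star> g = S2"
    have "sinv S1 \<star> S2 = (sinv S1 \<star> S1) \<star> g"
      using I S by (subst g[symmetric], subst lower_tri_mult_assoc) simp_all
    then show "g = sinv S1 \<star> S2" using I by simp
  qed
  with True show ?thesis by (simp add: gauss_factorization_def lower_tri_def upper_tri_def)
qed (auto simp: gauss_factorization_def lower_tri_def)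

text \<open>
  Row k of S1 is the k-th unit row vector minus the combination of the first k unit row vectors
  that makes the product with g vanish in the first k columns; the inverse of the k-th leading
  block gives its coefficients.
\<close>

lemma gauss_factorization_exists:
  assumes g: "blocks_invertible g"
  shows "\<exists>S1 S2. gauss_factorization g S1 S2"
proof -
  define S where "S k j = (if j = k then 1 else if j < k then - (\<Sum>i<k. g k i * block_inv k g i j) else 0)" for k j
  have S: "lower_tri S" by (simp add: lower_tri_def S_def)
  have "(S \<star> g) k i = 0" if "i < k" for k i
  proof -
    have "(S \<star> g) k i = (\<Sum>j<k. S k j * g j i) + g k i"
      by (simp add: lower_tri_mult_entry[OF S lessI]) (simp add: S_def)
    also have "(\<Sum>j<k. S k j * g j i) = - (\<Sum>j<k. \<Sum>m<k. g k m * block_inv k g m j * g j i)"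
      by (simp add: S_def sum_distrib_right sum_negf)
    also have "\<dots> = - (\<Sum>m<k. g k m * (\<Sum>j<k. block_inv k g m j * g j i))"
      unfolding sum_distrib_left by (subst sum.swap) (simp only: mult.assoc)
    also have "\<dots> = - (\<Sum>m<k. g k m * of_bool (m = i))"
      using that by (simp add: block_inv[OF g])
    also have "\<dots> = - g k i" using that by (simp add: sum_of_bool_mult_right)
    finally show ?thesis by simp
  qed
  then have "gauss_factorization g S (S \<star> g)"
    using S by (auto simp: gauss_factorization_iff upper_tri_def S_def)
  then show ?thesis by blast
qed

text \<open>
  The difference of row k of two candidates is supported on the first k places and annihilates the
  k-th leading block.
\<close>

lemma gauss_factorization_lower_unique:
  assumes g: "blocks_invertible g" and f: "gauss_factorization g A U" "gauss_factorization g B V"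
  shows "A = B"
proof (intro ext)
  fix k m :: nat
  have A: "lower_tri A" "\<And>i. A i i = 1" "upper_tri (A \<star> g)"
    and B: "lower_tri B" "\<And>i. B i i = 1" "upper_tri (B \<star> g)"
    using f by (auto simp: gauss_factorization_iff)
  have "A k m - B k m = 0" if "m < k"
  proof (rule block_row_zero[OF g _ that])
    fix i assume i: "i < k"
    then have "(A \<star> g) k i - (B \<star> g) k i = 0" using A B by (simp add: upper_tri_def)
    then show "(\<Sum>j<k. (A k j - B k j) * g j i) = 0"
      by (simp add: lower_tri_mult_entry[OF A(1) lessI] lower_tri_mult_entry[OF B(1) lessI] A B
          left_diff_distrib sum_subtractf)
  qed
  then show "A k m = B k m"
    using A B by (cases m k rule: linorder_cases) (auto simp: lower_tri_def)
qed

lemma gauss_factors: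
  assumes g: "blocks_invertible g"
  shows "gauss_factorization g (gauss_lower g) (gauss_upper g)"
proof -
  obtain A U where f: "gauss_factorization g A U" using gauss_factorization_exists[OF g] by blast
  have "gauss_lower g = A"
    unfolding gauss_lower_def
    by (rule the_equality) (use f gauss_factorization_lower_unique[OF g] in blast)+
  moreover have "gauss_upper g = U"
    unfolding gauss_upper_def
  proof (rule the_equality)
    fix V assume "\<exists>B. gauss_factorization g B V"
    then obtain B where B: "gauss_factorization g B V" ..
    then have "B = A" using f gauss_factorization_lower_unique[OF g] by blast
    then show "V = U" using B f by (auto simp: gauss_factorization_iff)
  qed (use f in blast)
  ultimately show ?thesis using f by simp
qed

text \<open>
  If the k-th diagonal entry of the upper factor vanished, row k of the lower factor would annihilate
  the leading block of size k + 1, although it ends with the entry 1.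
\<close>

lemma gauss_upper_diag:
  assumes g: "blocks_invertible g"
  shows "gauss_upper g k k \<noteq> 0"
proof
  assume 0: "gauss_upper g k k = 0"
  have S: "lower_tri (gauss_lower g)" "gauss_lower g k k = 1" "upper_tri (gauss_upper g)"
    "gauss_upper g = gauss_lower g \<star> g"
    using gauss_factors[OF g] by (auto simp: gauss_factorization_iff)
  have "gauss_lower g k k = 0"
  proof (rule block_row_zero[OF g, of "Suc k" "\<lambda>j. gauss_lower g k j" k])
    fix i assume "i < Suc k"
    then have "gauss_upper g k i = 0" using 0 S(3) by (cases "i = k") (auto simp: upper_tri_def)
    then show "(\<Sum>j<Suc k. gauss_lower g k j * g j i) = 0"
      by (simp only: S(4) lower_tri_mult_entry[OF S(1) lessI])
  qed simp
  with S(2) show False by simp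
qed

section \<open>The extended ordering\<close>

text \<open>
  Each full period contributes np non-negative and nm negative powers, and an incomplete period begins
  with the non-negative ones.
\<close>

definition nonneg_count :: "nat \<Rightarrow> nat \<Rightarrow> nat \<Rightarrow> nat" where
  "nonneg_count np nm l = (l div (np + nm)) * np + min (l mod (np + nm)) np"

definition neg_count :: "nat \<Rightarrow> nat \<Rightarrow> nat \<Rightarrow> nat" where
  "neg_count np nm l = (l div (np + nm)) * nm + (l mod (np + nm) - np)"

lemma chi_exp_count:
  "chi_exp np nm j = (if j mod (np + nm) < np then int (nonneg_count np nm j) else - int (neg_count np nm j) - 1)"
  by (simp add: chi_exp_def Let_def nonneg_count_def neg_count_def min_def)

lemma count_Suc:
  assumes "np > 0 \<or> nm > 0"
  shows "nonneg_count np nm (Suc l) = (if l mod (np + nm) < np then Suc (nonneg_count np nm l) else nonneg_count np nm l)"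
    and "neg_count np nm (Suc l) = (if l mod (np + nm) < np then neg_count np nm l else Suc (neg_count np nm l))"
proof -
  have r: "l mod (np + nm) < np + nm" using assms by simp
  show "nonneg_count np nm (Suc l) = (if l mod (np + nm) < np then Suc (nonneg_count np nm l) else nonneg_count np nm l)"
    using r by (auto simp: nonneg_count_def div_Suc mod_Suc algebra_simps min_def split: if_splits)
      (metis add.commute add_Suc_right mult_div_mod_eq)
  show "neg_count np nm (Suc l) = (if l mod (np + nm) < np then neg_count np nm l else Suc (neg_count np nm l))"
    using r by (auto simp: neg_count_def div_Suc mod_Suc algebra_simps split: if_splits)
qed

lemma count_sum:
  assumes "np > 0 \<or> nm > 0"
  shows "nonneg_count np nm l + neg_count np nm l = l"
  by (induction l) (simp_all add: count_Suc[OF assms], simp_all add: nonneg_count_def neg_count_def)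

text \<open>
  Each step extends the range of exponents by the next integer on one of its two ends, so no gap ever
  arises.  This makes the
  leading blocks of the moment matrix permuted Toeplitz matrices, and it yields injectivity and,
  when both kinds of powers occur, surjectivity of the ordering.
\<close>

lemma chi_exp_image:
  assumes "np > 0 \<or> nm > 0"
  shows "chi_exp np nm ` {..<l} = {- int (neg_count np nm l)..<int (nonneg_count np nm l)}"
proof (induction l)
  case (Suc l)
  then show ?case
    by (auto simp: lessThan_Suc count_Suc[OF assms] chi_exp_count[of _ _ l])
qed (simp add: nonneg_count_def neg_count_def)

lemma chi_exp_inj:
  assumes "np > 0 \<or> nm > 0"
  shows "inj (chi_exp np nm)"
proof (rule injI)
  fix i j assume eq: "chi_exp np nm i = chi_exp np nm j"
  define l where "l = Suc (max i j)"
  \<comment> \<open>l distinct integers lie in the interval, so no exponent can occur twice\<close>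
  have "card (chi_exp np nm ` {..<l}) = card {..<l}"
    using count_sum[OF assms, of l] by (simp add: chi_exp_image[OF assms] nat_int_add algebra_simps)
  then have "inj_on (chi_exp np nm) {..<l}" by (intro eq_card_imp_inj_on) auto
  then show "i = j" using eq by (auto simp: l_def inj_on_def)
qed

lemma chi_exp_bij:
  assumes "np > 0" "nm > 0"
  shows "bij (chi_exp np nm)"
proof (rule bijI)
  show "inj (chi_exp np nm)" using assms by (intro chi_exp_inj) simp
  show "surj (chi_exp np nm)"
    unfolding surj_def
  proof
    fix k :: int
    \<comment> \<open>after m full periods the powers from - m up to m - 1 have all occurred\<close>
    define m where "m = Suc (nat \<bar>k\<bar>)"
    let ?l = "m * (np + nm)"
    have "m \<le> nonneg_count np nm ?l" "m \<le> neg_count np nm ?l"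
      using assms by (simp_all add: nonneg_count_def neg_count_def)
    moreover have "- int m \<le> k" "k < int m" by (auto simp: m_def)
    ultimately have "k \<in> {- int (neg_count np nm ?l)..<int (nonneg_count np nm ?l)}" by simp
    then have "k \<in> chi_exp np nm ` {..<?l}"
      using assms by (subst chi_exp_image) auto
    then show "\<exists>j. k = chi_exp np nm j" by auto
  qed
qed

section \<open>Evaluation of Laurent polynomials\<close>

lemma leval_superset:
  assumes "finite F" "Poly_Mapping.keys f \<subseteq> F"
  shows "leval f z = (\<Sum>k\<in>F. Poly_Mapping.lookup f k * z powi k)"
  unfolding leval_def using assms
  by (intro sum.mono_neutral_left) (auto simp: in_keys_iff)

lemma leval_0 [simp]: "leval 0 z = 0"
  by (simp add: leval_def)

lemma leval_add: "leval (f + h) z = leval f z + leval h z"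
proof -
  let ?F = "Poly_Mapping.keys f \<union> Poly_Mapping.keys h"
  have F: "finite ?F" "Poly_Mapping.keys (f + h) \<subseteq> ?F"
    by (auto simp: in_keys_iff lookup_add)
  show ?thesis
    by (simp add: leval_superset[OF F] leval_superset[OF F(1), of f] leval_superset[OF F(1), of h]
        lookup_add algebra_simps sum.distrib)
qed

lemma leval_lscale: "leval (lscale c f) z = c * leval f z"
proof -
  have F: "finite (Poly_Mapping.keys f)" "Poly_Mapping.keys (lscale c f) \<subseteq> Poly_Mapping.keys f"
    by (auto simp: in_keys_iff lookup_lscale)
  show ?thesis
    by (simp add: leval_superset[OF F] leval_superset[OF F(1), of f] lookup_lscale sum_distrib_left mult.assoc)
qed

lemma leval_sum: "leval (\<Sum>i\<in>I. f i) z = (\<Sum>i\<in>I. leval (f i) z)"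
  by (induction I rule: infinite_finite_induct) (auto simp: leval_add)

lemma lookup_lconj: "Poly_Mapping.lookup (lconj f) k = cnj (Poly_Mapping.lookup f k)"
  by (simp add: lconj_def Poly_Mapping.map.rep_eq when_def)

lemma leval_lconj: "leval (lconj f) z = cnj (leval f (cnj z))"
proof -
  have F: "finite (Poly_Mapping.keys f)" "Poly_Mapping.keys (lconj f) \<subseteq> Poly_Mapping.keys f"
    by (auto simp: in_keys_iff lookup_lconj)
  show ?thesis
    by (simp add: leval_superset[OF F] leval_superset[OF F(1), of f] lookup_lconj)
qed

lemma leval_chi [simp]: "leval (chi np nm j) z = z powi chi_exp np nm j"
  by (simp add: leval_def chi_def)

lemma chi_vec_powi: "chi_vec np nm z j = z powi chi_exp np nm j"
  by (simp add: chi_vec_def)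

lemma apply_chi_lower:
  assumes "lower_tri A"
  shows "apply_chi A np nm k = (\<Sum>j\<le>k. lscale (A k j) (chi np nm j))"
  unfolding apply_chi_def
proof (rule sum.mono_neutral_left)
  show "{j. A k j \<noteq> 0} \<subseteq> {..k}"
    using assms by (auto simp: lower_tri_def) (meson linorder_not_less)
  show "\<forall>j\<in>{..k} - {j. A k j \<noteq> 0}. lscale (A k j) (chi np nm j) = 0"
    by (auto intro!: poly_mapping_eqI simp: lookup_lscale)
qed simp

section \<open>The moment matrix\<close>

context circle_measure
begin

abbreviation moment :: "int \<Rightarrow> complex" where
  "moment k \<equiv> cintegral \<mu> (\<lambda>z. z powi k)"

definition form :: "laurent \<Rightarrow> laurent \<Rightarrow> complex" where
  "form f h = cintegral \<mu> (\<lambda>z. leval f z * cnj (leval h z))"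

lemma circle_bounded_form: "circle_bounded (\<lambda>z. leval f z * cnj (leval h z))"
  by (intro circle_bounded_mult circle_bounded_cnj circle_bounded_leval)

lemma form_add_left: "form (f + f') h = form f h + form f' h"
  unfolding form_def leval_add distrib_right by (intro cintegral_add circle_bounded_form)

lemma form_scale_left: "form (lscale c f) h = c * form f h"
  unfolding form_def leval_lscale mult.assoc by (intro cintegral_scale circle_bounded_form)

lemma form_add_right: "form f (h + h') = form f h + form f h'"
  unfolding form_def leval_add complex_cnj_add distrib_left by (intro cintegral_add circle_bounded_form)

lemma form_scale_right: "form f (lscale c h) = cnj c * form f h"
  unfolding form_def leval_lscale complex_cnj_mult mult.left_commute[of _ "cnj c"]
  by (intro cintegral_scale circle_bounded_form)

lemma form_zero: "form 0 h = 0" "form f 0 = 0"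
  by (simp_all add: form_def cintegral_def)

lemma form_sum_left: "form (\<Sum>i\<in>I. f i) h = (\<Sum>i\<in>I. form (f i) h)"
  by (induction I rule: infinite_finite_induct) (auto simp: form_add_left form_zero)

lemma form_sum_right: "form f (\<Sum>i\<in>I. h i) = (\<Sum>i\<in>I. form f (h i))"
  by (induction I rule: infinite_finite_induct) (auto simp: form_add_right form_zero)

lemma gram_form: "gram \<mu> np nm i j = form (chi np nm i) (chi np nm j)"
  by (simp add: gram_def form_def chi_vec_def)

text \<open>
  On the circle complex conjugation is inversion, so the entries depend on differences of exponents
  only: g is a Toeplitz matrix up to the ordering of rows and columns.
\<close>

lemma gram_moment: "gram \<mu> np nm i j = moment (chi_exp np nm i - chi_exp np nm j)"
  unfolding gram_form form_def
proof (rule cintegral_cong_circle[OF circle_bounded_form circle_bounded_powi])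
  fix z :: complex assume z: "norm z = 1"
  then have "z * cnj z = 1" using complex_norm_square[of z] by simp
  then have "cnj z = inverse z" by (metis inverse_unique)
  moreover from z have "z \<noteq> 0" by auto
  ultimately show "leval (chi np nm i) z * cnj (leval (chi np nm j) z) = z powi (chi_exp np nm i - chi_exp np nm j)"
    by (simp add: power_int_diff power_int_inverse divide_inverse)
qed

end

lemma permuted_block_inverse:
  assumes "bij_betw e {..<l} {..<l}"
    and "\<And>i j. i < l \<Longrightarrow> j < l \<Longrightarrow> (\<Sum>k<l. A i k * B k j) = of_bool (i = j)"
    and ij: "i < l" "j < l"
  shows "(\<Sum>k<l. A (e i) (e k) * B (e k) (e j)) = (of_bool (i = j) :: complex)"
proof -
  have e: "e i < l" "e j < l" "e i = e j \<longleftrightarrow> i = j"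
    using assms(1) ij by (auto simp: bij_betw_def inj_on_def)
  have "(\<Sum>k<l. A (e i) (e k) * B (e k) (e j)) = (\<Sum>k<l. A (e i) k * B k (e j))"
    by (rule sum.reindex_bij_betw[OF assms(1)])
  then show ?thesis using assms(2)[OF e(1,2)] e(3) by simp
qed

locale quasi_definite_measure = circle_measure +
  fixes np nm :: nat
  assumes quasi_definite: "quasi_definite \<mu>" and period_pos: "np > 0 \<or> nm > 0"
begin

lemma toeplitz_inverse:
  "\<exists>B. \<forall>i<l. \<forall>j<l. (\<Sum>k<l. moment (int i - int k) * B k j) = of_bool (i = j)
     \<and> (\<Sum>k<l. B i k * moment (int k - int j)) = of_bool (i = j)"
proof (cases l)
  case (Suc n)
  let ?T = "Matrix.mat l l (\<lambda>(i, j). moment (int i - int j))"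
  have "Determinant.det ?T \<noteq> 0"
    using quasi_definite unfolding quasi_definite_def Suc by simp
  then have "?T \<in> Units (ring_mat TYPE(complex) l ())"
    by (intro det_non_zero_imp_unit) auto
  then obtain B where B: "B \<in> carrier_mat l l" "?T * B = 1\<^sub>m l" "B * ?T = 1\<^sub>m l"
    by (auto simp: Units_def ring_mat_def)
  have "(\<Sum>k<l. moment (int i - int k) * B $$ (k, j)) = of_bool (i = j)
     \<and> (\<Sum>k<l. B $$ (i, k) * moment (int k - int j)) = of_bool (i = j)" if "i < l" "j < l" for i j
  proof -
    have "(?T * B) $$ (i, j) = (\<Sum>k<l. moment (int i - int k) * B $$ (k, j))"
      "(B * ?T) $$ (i, j) = (\<Sum>k<l. B $$ (i, k) * moment (int k - int j))"
      using that B(1) by (auto simp: scalar_prod_def atLeast0LessThan intro!: sum.cong)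
    moreover have "(?T * B) $$ (i, j) = of_bool (i = j)" "(B * ?T) $$ (i, j) = of_bool (i = j)"
      using that by (simp_all add: B)
    ultimately show ?thesis by argo
  qed
  then show ?thesis by (intro exI[of _ "\<lambda>k j. B $$ (k, j)"]) simp
qed simp

text \<open>
  Shifting the exponents of the first l entries by the number of negative ones turns them into a
  permutation e of {0..<l}.  Hence the leading block is the non-singular l by l Toeplitz matrix with
  rows and columns both permuted by e, and its inverse is the permuted inverse.
\<close>

lemma gram_blocks_invertible: "blocks_invertible (gram \<mu> np nm)"
  unfolding blocks_invertible_def
proof
  fix l
  let ?E = "chi_exp np nm" and ?b = "neg_count np nm l" and ?a = "nonneg_count np nm l"
  define e where "e j = nat (?E j + int ?b)" for j
  have ab: "?a + ?b = l" by (rule count_sum[OF period_pos])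
  have E: "?E j \<in> {- int ?b..<int ?a}" if "j < l" for j
    using chi_exp_image[OF period_pos, of l] that by blast
  have eE: "int (e j) = ?E j + int ?b" if "j < l" for j
    using E[OF that] by (simp add: e_def)
  have e: "bij_betw e {..<l} {..<l}"
  proof -
    have "inj_on e {..<l}"
    proof (rule inj_onI)
      fix i j assume "i \<in> {..<l}" "j \<in> {..<l}" "e i = e j"
      then have "?E i = ?E j" using eE[of i] eE[of j] by simp
      then show "i = j" using chi_exp_inj[OF period_pos] by (simp add: inj_eq)
    qed
    moreover have "e ` {..<l} \<subseteq> {..<l}"
    proof safe
      fix j assume "j < l"
      then show "e j < l" using E[of j] eE[of j] ab by simp
    qed
    ultimately show ?thesis by (simp add: bij_betw_def endo_inj_surj)
  qed
  have g: "gram \<mu> np nm i j = moment (int (e i) - int (e j))" if "i < l" "j < l" for i j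
    using that by (simp add: gram_moment eE)
  obtain B where B: "\<And>i j. i < l \<Longrightarrow> j < l \<Longrightarrow> (\<Sum>k<l. moment (int i - int k) * B k j) = of_bool (i = j)"
     "\<And>i j. i < l \<Longrightarrow> j < l \<Longrightarrow> (\<Sum>k<l. B i k * moment (int k - int j)) = of_bool (i = j)"
    using toeplitz_inverse[of l] by blast
  show "\<exists>H. \<forall>i<l. \<forall>j<l. (\<Sum>k<l. gram \<mu> np nm i k * H k j) = of_bool (i = j) \<and>
      (\<Sum>k<l. H i k * gram \<mu> np nm k j) = of_bool (i = j)"
    using permuted_block_inverse[OF e B(1)] permuted_block_inverse[OF e B(2)]
    by (intro exI[of _ "\<lambda>i j. B (e i) (e j)"]) (simp add: g)
qed

end

section \<open>Projections along a dual family\<close>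

lemma span_triangular_family:
  fixes p :: "nat \<Rightarrow> laurent"
  assumes p: "\<And>k. p k = (\<Sum>j\<le>k. lscale (A k j) (b j))" and A: "\<And>k. A k k \<noteq> 0"
  shows "laurent.span (p ` {..<l}) = laurent.span (b ` {..<l})"
proof (intro laurent.span_eq[THEN iffD2] conjI image_subsetI)
  fix k assume "k \<in> {..<l}"
  then show "p k \<in> laurent.span (b ` {..<l})"
    unfolding p by (intro laurent.span_sum laurent.span_scale laurent.span_base) (auto intro!: imageI)
next
  fix k assume "k \<in> {..<l}"
  then show "b k \<in> laurent.span (p ` {..<l})"
  proof (induction k rule: less_induct)
    case (less k)
    have "p k = (\<Sum>j<k. lscale (A k j) (b j)) + lscale (A k k) (b k)"
      by (simp add: p lessThan_Suc_atMost[symmetric])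
    then have "lscale (inverse (A k k)) (p k - (\<Sum>j<k. lscale (A k j) (b j))) = b k"
      using A[of k] by simp
    moreover have "lscale (inverse (A k k)) (p k - (\<Sum>j<k. lscale (A k j) (b j))) \<in> laurent.span (p ` {..<l})"
      using less by (intro laurent.span_scale laurent.span_diff laurent.span_sum)
        (auto intro!: laurent.span_base)
    ultimately show ?case by simp
  qed
qed

text \<open>
  The sum on the right is linear in f, fixes p j for j < l and kills p j for j \<ge> l.  As the p j are
  related to the b j by a triangular matrix, it is the identity on the first subspace, vanishes on
  the second one, and leaves remainders in the second one; this characterizes the projection.  Both
  projections of the theorem are instances, with the roles of the two biorthogonal families
  exchanged.
\<close>

lemma proj_along_dual_family:
  fixes p :: "nat \<Rightarrow> laurent"
  assumes p: "\<And>k. p k = (\<Sum>j\<le>k. lscale (A k j) (b j))" and A: "\<And>k. A k k \<noteq> 0"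
    and b: "laurent.span (range b) = UNIV"
    and a: "\<And>k f h. a k (f + h) = a k f + a k h" "\<And>k c f. a k (lscale c f) = c * a k f"
    and dual: "\<And>k j. a k (p j) = of_bool (k = j)"
  shows "proj_along (laurent.span (b ` {..<l})) (laurent.span (p ` {l..})) f = (\<Sum>k<l. lscale (a k f) (p k))"
proof -
  let ?U = "laurent.span (b ` {..<l})" and ?W = "laurent.span (p ` {l..})"
  define P where "P f = (\<Sum>k<l. lscale (a k f) (p k))" for f
  have a0: "a k 0 = 0" for k using a(1)[of k 0 0] by simp
  have P0: "P 0 = 0" by (simp add: P_def a0)
  have Padd: "P (f + h) = P f + P h" for f h
    by (simp add: P_def a laurent.scale_left_distrib sum.distrib)
  have Pscale: "P (lscale c f) = lscale c (P f)" for c f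
    by (simp add: P_def a laurent.scale_sum_right)
  have Pp: "P (p j) = (if j < l then p j else 0)" for j
  proof -
    have "P (p j) = (\<Sum>k<l. if k = j then p j else 0)"
      unfolding P_def dual by (intro sum.cong) auto
    then show ?thesis by simp
  qed
  have U: "laurent.span (p ` {..<m}) = laurent.span (b ` {..<m})" for m
    by (rule span_triangular_family[OF p A])
  have PU: "P h = h" if "h \<in> ?U" for h
    using that unfolding U[symmetric]
    by (induction rule: laurent.span_induct_alt) (auto simp: P0 Padd Pscale Pp)
  have PW: "P h = 0" if "h \<in> ?W" for h
    using that by (induction rule: laurent.span_induct_alt) (auto simp: P0 Padd Pscale Pp)
  have "b k \<in> laurent.span (range p)" for k
    using laurent.span_mono[of "p ` {..<Suc k}" "range p"] U[of "Suc k"] laurent.span_base[of "b k" "b ` {..<Suc k}"]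
    by auto
  then have "laurent.span (range b) \<subseteq> laurent.span (range p)"
    by (intro laurent.span_minimal laurent.subspace_span) auto
  then have all: "h \<in> laurent.span (range p)" for h using b by auto
  have fP: "h - P h \<in> ?W" for h
    using all[of h]
  proof (induction rule: laurent.span_induct_alt)
    case (step c x y)
    then obtain j where j: "x = p j" by auto
    have eq: "lscale c x + y - P (lscale c x + y) = lscale c (x - P x) + (y - P y)"
      by (simp add: Padd Pscale laurent.scale_right_diff_distrib)
    have "x - P x \<in> ?W"
      by (cases "j < l") (auto simp: j Pp laurent.span_zero intro!: laurent.span_base)
    then have "lscale c (x - P x) + (y - P y) \<in> ?W"
      using step by (intro laurent.span_add laurent.span_scale)
    then show ?case by (simp only: eq)
  qed (simp add: P0 laurent.span_zero)
  have PinU: "P h \<in> ?U" for h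
    unfolding P_def U[symmetric] by (intro laurent.span_sum laurent.span_scale laurent.span_base) auto
  show ?thesis
    unfolding proj_along_def P_def[symmetric]
  proof (rule the_equality)
    fix h assume h: "h \<in> ?U \<and> f - h \<in> ?W"
    have "P f = P h + P (f - h)" by (simp add: Padd[symmetric])
    also have "\<dots> = h" using h PU PW by simp
    finally show "h = P f" by simp
  qed (use PinU fP in simp)
qed

lemma span_chi:
  assumes "np > 0" "nm > 0"
  shows "laurent.span (range (chi np nm)) = UNIV"
proof -
  have "f \<in> laurent.span (range (chi np nm))" for f
  proof -
    have "f = (\<Sum>k\<in>Poly_Mapping.keys f. lscale (Poly_Mapping.lookup f k) (Poly_Mapping.single k 1))"
    proof (rule poly_mapping_eqI)
      fix m
      have "(\<Sum>k\<in>Poly_Mapping.keys f. Poly_Mapping.lookup f k * Poly_Mapping.lookup (Poly_Mapping.single k 1) m)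
          = (\<Sum>k\<in>Poly_Mapping.keys f. if k = m then Poly_Mapping.lookup f m else 0)"
        by (intro sum.cong) (auto simp: lookup_single when_def)
      also have "\<dots> = Poly_Mapping.lookup f m" by (auto simp: in_keys_iff)
      finally show "Poly_Mapping.lookup f m = Poly_Mapping.lookup
          (\<Sum>k\<in>Poly_Mapping.keys f. lscale (Poly_Mapping.lookup f k) (Poly_Mapping.single k 1)) m"
        by (simp add: Poly_Mapping.lookup_sum lookup_lscale)
    qed
    also have "\<dots> \<in> laurent.span (range (chi np nm))"
    proof (intro laurent.span_sum laurent.span_scale laurent.span_base)
      fix k :: int
      obtain j where "chi_exp np nm j = k" using chi_exp_bij[OF assms] by (metis bij_pointE)
      then show "Poly_Mapping.single k 1 \<in> range (chi np nm)" by (auto simp: chi_def)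
    qed
    finally show ?thesis .
  qed
  then show ?thesis by auto
qed

section \<open>Biorthogonality and the kernel\<close>

lemma CD_kernel_eq:
  "CD_kernel \<mu> np nm l z z' = (\<Sum>k<l. leval (phi1 \<mu> np nm k) z' * cnj (leval (phi2 \<mu> np nm k) z))"
  by (simp add: CD_kernel_def leval_lconj)

context quasi_definite_measure
begin

abbreviation "g \<equiv> gram \<mu> np nm"
abbreviation "S \<equiv> gauss_lower g"
abbreviation "U \<equiv> gauss_upper g"
abbreviation "T \<equiv> sinv U"

lemma gauss_gram: "lower_tri S" "S k k = 1" "upper_tri U" "S \<star> g = U"
  using gauss_factors[OF gram_blocks_invertible] by (auto simp: gauss_factorization_iff)

lemma gauss_upper_inverse: "upper_tri T" "T k k \<noteq> 0" "U \<star> T = sident" "T \<star> U = sident"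
  using upper_tri_inverse[OF gauss_gram(3)] gauss_upper_diag[OF gram_blocks_invertible] by auto

lemma phi1_sum: "phi1 \<mu> np nm k = (\<Sum>j\<le>k. lscale (S k j) (chi np nm j))"
  unfolding phi1_def by (rule apply_chi_lower[OF gauss_gram(1)])

lemma phi2_sum: "phi2 \<mu> np nm k = (\<Sum>j\<le>k. lscale (cnj (T j k)) (chi np nm j))"
proof -
  have "lower_tri (sdagger T)"
    using gauss_upper_inverse(1) by (simp add: lower_tri_def upper_tri_def sdagger_def)
  from apply_chi_lower[OF this] show ?thesis by (simp add: phi2_def sdagger_def)
qed

text \<open>
  The form turns the two families of coefficients into the matrix S g T, where S g = U is the upper
  Gauss factor and T is its inverse.
\<close>

lemma biorthogonal: "form (phi1 \<mu> np nm k) (phi2 \<mu> np nm m) = of_bool (k = m)"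
proof -
  have "form (phi1 \<mu> np nm k) (phi2 \<mu> np nm m) = (\<Sum>j\<le>m. T j m * (\<Sum>i\<le>k. S k i * g i j))"
    by (simp add: phi1_sum phi2_sum form_sum_right form_scale_right form_sum_left form_scale_left
        flip: gram_form)
  also have "\<dots> = (\<Sum>j<Suc m. U k j * T j m)"
    by (simp only: lessThan_Suc_atMost[symmetric] gauss_gram(4)[symmetric]
        lower_tri_mult_entry[OF gauss_gram(1) lessI] mult.commute)
  also have "\<dots> = (U \<star> T) k m"
    by (rule upper_tri_mult_entry[OF gauss_upper_inverse(1) lessI, symmetric])
  finally show ?thesis by (simp add: gauss_upper_inverse sident_def)
qed

text \<open>
  The coefficient matrix of the kernel is the product of the leading blocks of T and S.  Since
  T (S g) = T U = 1 and triangularity keeps all sums inside the block, this product is a left inverse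
  of the leading block of g, hence its inverse.
\<close>

lemma CD_kernel_block_inv:
  "CD_kernel \<mu> np nm l z z' =
     (\<Sum>i<l. \<Sum>j<l. cnj (chi_vec np nm z i) * block_inv l g i j * chi_vec np nm z' j)"
proof -
  have G: "block_inv l g i j = (\<Sum>k<l. T i k * S k j)" if "i < l" "j < l" for i j
  proof (rule block_inv_unique[OF gram_blocks_invertible _ that, where M = "\<lambda>i j. \<Sum>k<l. T i k * S k j"])
    fix i j assume ij: "i < l" "j < l"
    have "(\<Sum>k<l. (\<Sum>m<l. T i m * S m k) * g k j) = (\<Sum>m<l. T i m * (\<Sum>k<l. S m k * g k j))"
      unfolding sum_distrib_left sum_distrib_right by (subst sum.swap) (simp only: mult.assoc)
    also have "\<dots> = (\<Sum>m<l. T i m * U m j)"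
      by (intro sum.cong refl)
        (simp add: gauss_gram(4)[symmetric] lower_tri_mult_entry[OF gauss_gram(1), of _ l])
    also have "\<dots> = (T \<star> U) i j"
      by (rule upper_tri_mult_entry[OF gauss_gram(3) ij(2), symmetric])
    finally show "(\<Sum>k<l. (\<Sum>m<l. T i m * S m k) * g k j) = of_bool (i = j)"
      by (simp add: gauss_upper_inverse sident_def)
  qed
  have p1: "leval (phi1 \<mu> np nm k) z' = (\<Sum>j<l. S k j * chi_vec np nm z' j)" if "k < l" for k
    unfolding phi1_sum leval_sum leval_lscale chi_vec_def using that gauss_gram(1)
    by (intro sum.mono_neutral_left) (auto simp: lower_tri_def)
  have p2: "cnj (leval (phi2 \<mu> np nm k) z) = (\<Sum>i<l. T i k * cnj (chi_vec np nm z i))" if "k < l" for k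
    unfolding phi2_sum leval_sum leval_lscale chi_vec_def cnj_sum complex_cnj_mult complex_cnj_cnj
    using that gauss_upper_inverse(1)
    by (intro sum.mono_neutral_left) (auto simp: upper_tri_def)
  have "CD_kernel \<mu> np nm l z z' =
      (\<Sum>k<l. \<Sum>j<l. \<Sum>i<l. cnj (chi_vec np nm z i) * (T i k * S k j) * chi_vec np nm z' j)"
    unfolding CD_kernel_eq
    by (intro sum.cong refl) (simp add: p1 p2 sum_product mult_ac)
  also have "\<dots> = (\<Sum>k<l. \<Sum>i<l. \<Sum>j<l. cnj (chi_vec np nm z i) * (T i k * S k j) * chi_vec np nm z' j)"
    by (intro sum.cong refl sum.swap)
  also have "\<dots> = (\<Sum>i<l. \<Sum>k<l. \<Sum>j<l. cnj (chi_vec np nm z i) * (T i k * S k j) * chi_vec np nm z' j)"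
    by (rule sum.swap)
  also have "\<dots> = (\<Sum>i<l. \<Sum>j<l. \<Sum>k<l. cnj (chi_vec np nm z i) * (T i k * S k j) * chi_vec np nm z' j)"
    by (intro sum.cong refl sum.swap)
  also have "\<dots> = (\<Sum>i<l. \<Sum>j<l. cnj (chi_vec np nm z i) * block_inv l g i j * chi_vec np nm z' j)"
    by (intro sum.cong refl) (simp add: G sum_distrib_left sum_distrib_right)
  finally show ?thesis .
qed

text \<open>
  Integrating the product of the two kernels over u produces the pairings of the two families, and
  biorthogonality collapses the double sum to its diagonal.
\<close>

lemma CD_kernel_reproducing:
  "CD_kernel \<mu> np nm l z z' = cintegral \<mu> (\<lambda>u. CD_kernel \<mu> np nm l z u * CD_kernel \<mu> np nm l u z')"
proof -
  let ?p = "phi1 \<mu> np nm" and ?q = "phi2 \<mu> np nm"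
  have "cintegral \<mu> (\<lambda>u. CD_kernel \<mu> np nm l z u * CD_kernel \<mu> np nm l u z')
      = cintegral \<mu> (\<lambda>u. \<Sum>k<l. \<Sum>m<l. (cnj (leval (?q k) z) * leval (?p m) z') * (leval (?p k) u * cnj (leval (?q m) u)))"
    unfolding CD_kernel_eq by (simp add: sum_product mult_ac)
  also have "\<dots> = cintegral \<mu> (\<lambda>u. \<Sum>(k,m)\<in>{..<l}\<times>{..<l}. (cnj (leval (?q k) z) * leval (?p m) z') * (leval (?p k) u * cnj (leval (?q m) u)))"
    by (simp add: sum.cartesian_product)
  also have "\<dots> = (\<Sum>(k,m)\<in>{..<l}\<times>{..<l}. (cnj (leval (?q k) z) * leval (?p m) z') * form (?p k) (?q m))"
    unfolding form_def case_prod_unfold by (intro cintegral_sum circle_bounded_form)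
  also have "\<dots> = (\<Sum>k<l. \<Sum>m<l. (cnj (leval (?q k) z) * leval (?p m) z') * of_bool (k = m))"
    by (subst sum.cartesian_product) (simp only: biorthogonal)
  also have "\<dots> = (\<Sum>k<l. cnj (leval (?q k) z) * leval (?p k) z')"
    by (intro sum.cong refl) (simp add: sum_of_bool_mult_left mult.commute[of _ "of_bool _"])
  finally show ?thesis by (simp add: CD_kernel_eq mult.commute)
qed

lemma proj2_kernel:
  assumes "np > 0" "nm > 0"
  shows "leval (proj2 \<mu> np nm l f) z' = cintegral \<mu> (\<lambda>z. CD_kernel \<mu> np nm l z z' * leval f z)"
proof -
  let ?p = "phi1 \<mu> np nm" and ?q = "phi2 \<mu> np nm"
  have "proj2 \<mu> np nm l f = (\<Sum>k<l. lscale (form f (?q k)) (?p k))"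
    unfolding proj2_def Lam_def perp2_def
    by (rule proj_along_dual_family[OF phi1_sum _ span_chi[OF assms]])
      (auto simp: gauss_gram form_add_left form_scale_left biorthogonal)
  then have "leval (proj2 \<mu> np nm l f) z' = (\<Sum>k<l. leval (?p k) z' * form f (?q k))"
    by (simp add: leval_sum leval_lscale mult.commute)
  also have "\<dots> = cintegral \<mu> (\<lambda>z. \<Sum>k<l. leval (?p k) z' * (leval f z * cnj (leval (?q k) z)))"
    unfolding form_def by (intro cintegral_sum[symmetric] circle_bounded_form)
  finally show ?thesis by (simp add: CD_kernel_eq sum_distrib_left sum_distrib_right mult_ac)
qed

text \<open>
  The coefficient functional dual to the second family has to be linear in f, whereas the form is
  conjugate-linear in its second argument; this is why the conjugate of the projection appears.
\<close>

lemma proj1_kernel: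
  assumes "np > 0" "nm > 0"
  shows "cnj (leval (proj1 \<mu> np nm l f) z) =
    cintegral \<mu> (\<lambda>z'. CD_kernel \<mu> np nm l z z' * leval (lconj f) (cnj z'))"
proof -
  let ?p = "phi1 \<mu> np nm" and ?q = "phi2 \<mu> np nm"
  have "proj1 \<mu> np nm l f = (\<Sum>k<l. lscale (cnj (form (?p k) f)) (?q k))"
    unfolding proj1_def Lam_def perp1_def
    by (rule proj_along_dual_family[OF phi2_sum _ span_chi[OF assms]])
      (simp_all add: gauss_upper_inverse form_add_right form_scale_right biorthogonal)
  then have "cnj (leval (proj1 \<mu> np nm l f) z) = (\<Sum>k<l. cnj (leval (?q k) z) * form (?p k) f)"
    by (simp add: leval_sum leval_lscale mult.commute)
  also have "\<dots> = cintegral \<mu> (\<lambda>z'. \<Sum>k<l. cnj (leval (?q k) z) * (leval (?p k) z' * cnj (leval f z')))"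
    unfolding form_def by (intro cintegral_sum[symmetric] circle_bounded_form)
  finally show ?thesis by (simp add: CD_kernel_eq leval_lconj sum_distrib_left sum_distrib_right mult_ac)
qed

end

section \<open>The shift matrix\<close>

lemma Lambda1_entry: "Lambda1 np nm i j = of_bool (0 \<le> chi_exp np nm i \<and> chi_exp np nm j = chi_exp np nm i + 1)"
proof -
  have "Lambda1 np nm i j = (\<Sum>k\<in>{nat (chi_exp np nm i)}. e1 np nm k i * e1 np nm (Suc k) j)"
    unfolding Lambda1_def by (rule suminf_finite) (auto simp: e1_def)
  then show ?thesis by (auto simp: e1_def)
qed

lemma Lambda2_entry: "Lambda2 np nm i j = of_bool (chi_exp np nm i < 0 \<and> chi_exp np nm j = chi_exp np nm i - 1)"
proof -
  have "Lambda2 np nm i j = (\<Sum>k\<in>{nat (- chi_exp np nm i - 1)}. e2 np nm k i * e2 np nm (Suc k) j)"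
    unfolding Lambda2_def by (rule suminf_finite) (auto simp: e2_def)
  then show ?thesis by (auto simp: e2_def)
qed

lemma stransp_Lambda_entry: "stransp Lambda i j = of_bool (i = Suc j)"
proof -
  have "stransp Lambda i j = (\<Sum>k\<in>{j}. munit k (Suc k) j i)"
    unfolding Lambda_def stransp_def by (rule suminf_finite) (auto simp: munit_def)
  then show ?thesis by (auto simp: munit_def)
qed

lemma spower_stransp_Lambda: "spower (stransp Lambda) n i j = of_bool (i = j + n)"
proof (induction n arbitrary: i)
  case (Suc n)
  have "spower (stransp Lambda) (Suc n) i j
      = (\<Sum>k\<in>{j + n}. stransp Lambda i k * spower (stransp Lambda) n k j)"
    by (simp only: spower.simps smat_mult_def) (rule suminf_finite, auto simp: Suc)
  also have "\<dots> = of_bool (i = j + Suc n)" by (simp add: Suc stransp_Lambda_entry)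
  finally show ?case .
qed (simp add: sident_def)

text \<open>
  The two shifts act within the non-negative and within the negative powers; the remaining matrix unit,
  in row np (where the exponent is - 1) and column 0, joins them to the shift by 1 on all exponents.
\<close>

lemma Upsilon_entry:
  assumes "np > 0" "nm > 0"
  shows "Upsilon np nm i j = of_bool (chi_exp np nm j = chi_exp np nm i + 1)"
proof -
  let ?E = "chi_exp np nm"
  have inj: "inj ?E" using assms by (intro chi_exp_inj) simp
  have "?E np = - 1" "?E 0 = 0" using assms by (simp_all add: chi_exp_def)
  then have E: "i = np \<longleftrightarrow> ?E i = - 1" "j = 0 \<longleftrightarrow> ?E j = 0"
    using inj by (metis injD)+
  have "(munit np np \<star> spower (stransp Lambda) np) i j
      = (\<Sum>k\<in>{np}. munit np np i k * spower (stransp Lambda) np k j)"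
    unfolding smat_mult_def by (rule suminf_finite) (auto simp: munit_def)
  also have "\<dots> = of_bool (?E i = - 1 \<and> ?E j = 0)"
    by (auto simp: munit_def spower_stransp_Lambda E[symmetric])
  finally show ?thesis
    by (auto simp: Upsilon_def Lambda1_entry Lambda2_entry stransp_def)
qed

lemma row_col_vdagger_block:
  "vdagger (vblock {..<l} a) \<star>\<^sub>v w = (\<Sum>i<l. cnj (a i) * w i)"
proof -
  have "vdagger (vblock {..<l} a) \<star>\<^sub>v w = (\<Sum>i<l. vdagger (vblock {..<l} a) i * w i)"
    unfolding row_col_def by (rule suminf_finite) (auto simp: vdagger_def vblock_def)
  then show ?thesis by (simp add: vdagger_def vblock_def)
qed

lemma block_inv_col: "(block_inv l A \<star>\<^sub>c w) i = (\<Sum>k<l. block_inv l A i k * w k)"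
  unfolding mat_col_def by (rule suminf_finite) (auto simp: block_inv_def)

lemma block_entry: "block I J A i j = (if i \<in> I \<and> j \<in> J then A i j else 0)"
  by (simp add: block_def)

lemma col_block: "(block I {..<l} A \<star>\<^sub>c w) i = (if i \<in> I then \<Sum>k<l. A i k * w k else 0)"
proof -
  have "(block I {..<l} A \<star>\<^sub>c w) i = (\<Sum>k<l. block I {..<l} A i k * w k)"
    unfolding mat_col_def by (rule suminf_finite) (auto simp: block_def)
  then show ?thesis by (auto simp: block_def)
qed

lemma row_vdagger_block_inv:
  "(vdagger (vblock {..<l} a) \<star>\<^sub>r block_inv l A) j = (\<Sum>i<l. cnj (a i) * block_inv l A i j)"
proof -
  have "(vdagger (vblock {..<l} a) \<star>\<^sub>r block_inv l A) j = (\<Sum>i<l. vdagger (vblock {..<l} a) i * block_inv l A i j)"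
    unfolding row_mat_def by (rule suminf_finite) (auto simp: block_inv_def)
  then show ?thesis by (simp add: vdagger_def vblock_def)
qed

lemma row_block:
  "(v \<star>\<^sub>r block {..<l} J A) j = (if j \<in> J then \<Sum>k<l. v k * A k j else 0)"
proof -
  have "(v \<star>\<^sub>r block {..<l} J A) j = (\<Sum>k<l. v k * block {..<l} J A k j)"
    unfolding row_mat_def by (rule suminf_finite) (auto simp: block_def)
  then show ?thesis by (auto simp: block_def)
qed

section \<open>The Christoffel--Darboux formula\<close>

context quasi_definite_measure
begin

lemma CD_kernel_quadratic_form:
  "CD_kernel \<mu> np nm l z z' =
     vdagger (vblock {..<l} (chi_vec np nm z)) \<star>\<^sub>v block_inv l g \<star>\<^sub>c vblock {..<l} (chi_vec np nm z')"
  unfolding CD_kernel_block_inv row_col_vdagger_block block_inv_col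
  by (simp add: vblock_def sum_distrib_left mult.assoc)

text \<open>
  Write u = G y and t = x G, and let the shift matrix send index i to succ i, with inverse pred.
  The Toeplitz property says that g i (pred j) = g (succ i) j.  The first term of the right-hand side
  is a sum over the j < l with pred j \<ge> l.  For pred j < l the summand would contain
  (t g)(pred j) - x (pred j) = 0, so the restriction can be dropped; the same holds for the second
  term.  Without the restrictions the double sums in g cancel by the Toeplitz property, and what is
  left are the two sums in which the shift acts on \<chi>, as multiplication by z' and by the conjugate
  of the inverse of z.
\<close>

lemma CD_kernel_shift:
  assumes np: "np > 0" "nm > 0" and z: "z \<noteq> 0" "z' \<noteq> 0"
  shows "(z' - inverse (cnj z)) * CD_kernel \<mu> np nm l z z' =
    ((\<lambda>j. (vdagger (vblock {..<l} (chi_vec np nm z)) \<star>\<^sub>r block_inv l g \<star>\<^sub>r block {..<l} {l..} g) j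
          - vdagger (vblock {l..} (chi_vec np nm z)) j)
        \<star>\<^sub>v block {l..} {..<l} (Upsilon np nm) \<star>\<^sub>c block_inv l g \<star>\<^sub>c vblock {..<l} (chi_vec np nm z'))
    - (vdagger (vblock {..<l} (chi_vec np nm z)) \<star>\<^sub>v block_inv l g \<star>\<^sub>c block {..<l} {l..} (Upsilon np nm) \<star>\<^sub>c
        (\<lambda>i. (block {l..} {..<l} g \<star>\<^sub>c block_inv l g \<star>\<^sub>c vblock {..<l} (chi_vec np nm z')) i
          - vblock {l..} (chi_vec np nm z') i))"
    (is "_ = ?term1 - ?term2")
proof -
  let ?E = "chi_exp np nm" and ?G = "block_inv l g"
  define a where "a = (\<lambda>j. cnj (chi_vec np nm z j))"
  define b where "b = chi_vec np nm z'"
  define succ where "succ i = inv_into UNIV ?E (?E i + 1)" for i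
  define pred where "pred j = inv_into UNIV ?E (?E j - 1)" for j
  note bij = chi_exp_bij[OF np]
  have E: "?E (succ i) = ?E i + 1" "?E (pred j) = ?E j - 1" for i j
    using bij by (simp_all add: succ_def pred_def bij_is_surj surj_f_inv_f)
  have Einj: "?E i = ?E j \<longleftrightarrow> i = j" for i j using bij by (simp add: bij_is_inj inj_eq)
  have sp: "succ (pred j) = j" for j using E by (simp flip: Einj)
  have Y: "Upsilon np nm i j = of_bool (j = succ i)" for i j
    using E(1)[of i] by (auto simp: Upsilon_entry[OF np] simp flip: Einj)
  have Y': "j = succ i \<longleftrightarrow> i = pred j" for i j
    using E by (auto simp flip: Einj)
  have gsp: "g i (pred j) = g (succ i) j" for i j
    by (simp add: gram_moment E algebra_simps)
  have b: "b (succ i) = z' * b i" for i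
    using z by (simp add: b_def chi_vec_powi E power_int_add)
  have a: "a (pred j) = inverse (cnj z) * a j" for j
    using z by (simp add: a_def chi_vec_powi E power_int_diff field_simps)
  define u where "u = ?G \<star>\<^sub>c vblock {..<l} b"
  define t where "t = vdagger (vblock {..<l} (chi_vec np nm z)) \<star>\<^sub>r ?G"
  have u: "u i = (\<Sum>k<l. ?G i k * b k)" for i
    by (simp add: u_def block_inv_col vblock_def)
  have t: "t j = (\<Sum>i<l. a i * ?G i j)" for j
    by (simp add: t_def row_vdagger_block_inv a_def)
  have gu: "(\<Sum>j<l. g m j * u j) = b m" if "m < l" for m
  proof -
    have "(\<Sum>j<l. g m j * u j) = (\<Sum>k<l. (\<Sum>j<l. g m j * ?G j k) * b k)"
      unfolding u sum_distrib_left sum_distrib_right by (subst sum.swap) (simp only: mult.assoc)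
    also have "\<dots> = (\<Sum>k<l. of_bool (m = k) * b k)"
      using that by (simp add: block_inv[OF gram_blocks_invertible])
    finally show ?thesis using that by (simp add: sum_of_bool_mult_left)
  qed
  have tg: "(\<Sum>i<l. t i * g i m) = a m" if "m < l" for m
  proof -
    have "(\<Sum>i<l. t i * g i m) = (\<Sum>k<l. a k * (\<Sum>i<l. ?G k i * g i m))"
      unfolding t sum_distrib_left sum_distrib_right by (subst sum.swap) (simp only: mult.assoc)
    also have "\<dots> = (\<Sum>k<l. a k * of_bool (k = m))"
      using that by (simp add: block_inv[OF gram_blocks_invertible])
    finally show ?thesis using that by (simp add: sum_of_bool_mult_right)
  qed
  have Ku: "CD_kernel \<mu> np nm l z z' = (\<Sum>i<l. a i * u i)"
    by (simp add: CD_kernel_block_inv u a_def b_def sum_distrib_left mult.assoc)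
  have tw: "(\<Sum>i<l. a i * (\<Sum>k<l. ?G i k * w k)) = (\<Sum>k<l. t k * w k)" for w
    unfolding t sum_distrib_left sum_distrib_right by (subst sum.swap) (simp only: mult.assoc)
  have Kt: "CD_kernel \<mu> np nm l z z' = (\<Sum>k<l. t k * b k)"
    unfolding Ku u by (rule tw)
  have term1: "?term1 = (\<Sum>j<l. ((\<Sum>i<l. t i * g i (pred j)) - a (pred j)) * u j)"
  proof -
    define W where "W j = (t \<star>\<^sub>r block {..<l} {l..} g) j - vdagger (vblock {l..} (chi_vec np nm z)) j" for j
    define V where "V = block {l..} {..<l} (Upsilon np nm) \<star>\<^sub>c u"
    have V: "V i = (if l \<le> i \<and> succ i < l then u (succ i) else 0)" for i
    proof -
      have "(\<Sum>k<l. Upsilon np nm i k * u k) = (\<Sum>k<l. if k = succ i then u k else 0)"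
        by (intro sum.cong) (auto simp: Y)
      then show ?thesis by (simp add: V_def col_block)
    qed
    have "?term1 = suminf (\<lambda>i. W i * V i)"
      by (simp add: row_col_def W_def V_def t_def u_def b_def)
    \<comment> \<open>W has infinite support, but only finitely many rows of the shift matrix reach the first l columns\<close>
    also have "\<dots> = (\<Sum>i\<in>pred ` {..<l}. W i * V i)"
    proof (rule suminf_finite)
      fix i assume "i \<notin> pred ` {..<l}"
      then have "\<not> succ i < l" using Y' by blast
      then show "W i * V i = 0" by (simp add: V)
    qed simp
    also have "\<dots> = (\<Sum>j<l. W (pred j) * V (pred j))"
      by (rule sum.reindex_cong[OF _ refl refl]) (metis inj_on_inverseI sp)
    also have "\<dots> = (\<Sum>j<l. ((\<Sum>i<l. t i * g i (pred j)) - a (pred j)) * u j)"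
    proof (rule sum.cong[OF refl])
      fix j assume j: "j \<in> {..<l}"
      show "W (pred j) * V (pred j) = ((\<Sum>i<l. t i * g i (pred j)) - a (pred j)) * u j"
      proof (cases "pred j < l")
        case True
        then show ?thesis using tg by (simp add: V)
      next
        case False
        then show ?thesis using j
          by (simp add: W_def V sp row_block vdagger_def vblock_def a_def)
      qed
    qed
    finally show ?thesis .
  qed
  have term2: "?term2 = (\<Sum>k<l. t k * ((\<Sum>j<l. g (succ k) j * u j) - b (succ k)))"
  proof -
    define V where "V i = (block {l..} {..<l} g \<star>\<^sub>c u) i - vblock {l..} b i" for i
    have "?term2 = (\<Sum>k<l. t k * (block {..<l} {l..} (Upsilon np nm) \<star>\<^sub>c V) k)"
      by (simp add: row_col_vdagger_block block_inv_col V_def[abs_def] u_def b_def a_def flip: tw)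
    also have "\<dots> = (\<Sum>k<l. t k * ((\<Sum>j<l. g (succ k) j * u j) - b (succ k)))"
    proof (intro sum.cong refl arg_cong2[where f="(*)"])
      fix k assume k: "k \<in> {..<l}"
      have "(block {..<l} {l..} (Upsilon np nm) \<star>\<^sub>c V) k
          = (\<Sum>m\<in>{succ k}. block {..<l} {l..} (Upsilon np nm) k m * V m)"
        unfolding mat_col_def by (rule suminf_finite) (auto simp: block_def Y)
      then show "(block {..<l} {l..} (Upsilon np nm) \<star>\<^sub>c V) k = (\<Sum>j<l. g (succ k) j * u j) - b (succ k)"
        using k gu by (auto simp: block_entry Y V_def col_block vblock_def not_le)
    qed
    finally show ?thesis .
  qed
  have "(\<Sum>j<l. (\<Sum>i<l. t i * g i (pred j)) * u j) = (\<Sum>k<l. t k * (\<Sum>j<l. g (succ k) j * u j))"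
    unfolding gsp sum_distrib_left sum_distrib_right by (subst sum.swap) (simp only: mult.assoc)
  then have "?term1 - ?term2 = (\<Sum>k<l. t k * b (succ k)) - (\<Sum>j<l. a (pred j) * u j)"
    unfolding term1 term2 by (simp add: left_diff_distrib right_diff_distrib sum_subtractf)
  also have "\<dots> = z' * (\<Sum>k<l. t k * b k) - inverse (cnj z) * (\<Sum>j<l. a j * u j)"
    by (simp add: a b sum_distrib_left mult_ac)
  also have "\<dots> = (z' - inverse (cnj z)) * CD_kernel \<mu> np nm l z z'"
    by (simp add: Kt[symmetric] Ku[symmetric] left_diff_distrib)
  finally show ?thesis ..
qed

end

theorem proposition24:
  fixes \<mu> :: "complex set \<Rightarrow> complex" and np nm l :: nat
  assumes "complex_borel_measure \<mu>"
    and "supported_on_circle \<mu>"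
    and "quasi_definite \<mu>"
    and "np > 0 \<or> nm > 0"
  shows
    "(np > 0 \<and> nm > 0 \<longrightarrow>
       (\<forall>f z'. z' \<noteq> 0 \<longrightarrow>
          leval (proj2 \<mu> np nm l f) z' =
            cintegral \<mu> (\<lambda>z. CD_kernel \<mu> np nm l z z' * leval f z)) \<and>
       (\<forall>f z. z \<noteq> 0 \<longrightarrow>
          cnj (leval (proj1 \<mu> np nm l f) z) =
            cintegral \<mu> (\<lambda>z'. CD_kernel \<mu> np nm l z z' * leval (lconj f) (cnj z'))))
     \<and>
     (\<forall>z z'. z \<noteq> 0 \<longrightarrow> z' \<noteq> 0 \<longrightarrow>
        CD_kernel \<mu> np nm l z z' =
          cintegral \<mu> (\<lambda>u. CD_kernel \<mu> np nm l z u * CD_kernel \<mu> np nm l u z'))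
     \<and>
     (\<forall>z z'. z \<noteq> 0 \<longrightarrow> z' \<noteq> 0 \<longrightarrow>
        (let g = gram \<mu> np nm;
             G = block_inv l g;
             Y = Upsilon np nm;
             lo = {..<l};
             hi = {l..};
             x = vdagger (vblock lo (chi_vec np nm z));
             xh = vdagger (vblock hi (chi_vec np nm z));
             y = vblock lo (chi_vec np nm z');
             yh = vblock hi (chi_vec np nm z');
             K = CD_kernel \<mu> np nm l z z'
         in
           K = x \<star>\<^sub>v G \<star>\<^sub>c y
           \<and>
           (z' - inverse (cnj z)) * K =
             (x \<star>\<^sub>v G \<star>\<^sub>c (\<lambda>i. z' * y i)) - inverse (cnj z) * (x \<star>\<^sub>v G \<star>\<^sub>c y)
           \<and>
           (np > 0 \<and> nm > 0 \<longrightarrow>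
             (z' - inverse (cnj z)) * K =
               ((\<lambda>j. (x \<star>\<^sub>r G \<star>\<^sub>r block lo hi g) j - xh j)
                   \<star>\<^sub>v block hi lo Y \<star>\<^sub>c G \<star>\<^sub>c y)
               - (x \<star>\<^sub>v G \<star>\<^sub>c block lo hi Y \<star>\<^sub>c
                   (\<lambda>i. (block hi lo g \<star>\<^sub>c G \<star>\<^sub>c y) i - yh i)))))"
proof -
  interpret quasi_definite_measure \<mu> np nm
    using assms by unfold_locales
  have linear: "vdagger (vblock {..<l} v) \<star>\<^sub>v block_inv l g \<star>\<^sub>c (\<lambda>i. c * w i)
      = c * (vdagger (vblock {..<l} v) \<star>\<^sub>v block_inv l g \<star>\<^sub>c w)" for v w c
    by (simp add: row_col_vdagger_block block_inv_col sum_distrib_left mult_ac)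
  show ?thesis
    unfolding Let_def
  proof (intro conjI allI impI)
    fix z z'
    show "(z' - inverse (cnj z)) * CD_kernel \<mu> np nm l z z' =
       (vdagger (vblock {..<l} (chi_vec np nm z)) \<star>\<^sub>v block_inv l g \<star>\<^sub>c (\<lambda>i. z' * vblock {..<l} (chi_vec np nm z') i))
       - inverse (cnj z) * (vdagger (vblock {..<l} (chi_vec np nm z)) \<star>\<^sub>v block_inv l g \<star>\<^sub>c vblock {..<l} (chi_vec np nm z'))"
      by (simp only: linear CD_kernel_quadratic_form left_diff_distrib)
  qed (use proj1_kernel proj2_kernel CD_kernel_reproducing CD_kernel_quadratic_form CD_kernel_shift in blast)+
qed

end
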